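(* Let $K$ be an algebraically closed field with characteristic exponent $p$, let $d$ be a nonnegative integer that is not of the form $c\cdot p^k$ with $c\in\{0,1,2\}$ and $k\in\mathbb{Z}_{\ge0}$, and let $V$ be a finite-dimensional $K$-vector space. For any $f\in S^dV$, the symmetric Hilbert–Mumford subrank $Q_{\mathrm{HM},s}(f)$ equals the symmetric subrank $Q_s(f)$.
   Context: The characteristic exponent of $K$ is $1$ if $\operatorname{char}K=0$ and $\operatorname{char}K$ otherwise. $S^dV$ is the $d$-th symmetric power of $V$ (quotient of $V^{\otimes d}$ by the span of all $T-\sigma(T)$, $\sigma\in S_d$). A linear map $\varphi:V\to W$ acts by $\varphi(v_1\cdots v_d)=(\varphi v_1)\cdots(\varphi v_d)$; in particular $\operatorname{GL}(V)$ acts on $S^dV$. The unit tensor is $I_r=e_1^d+\dots+e_r^d\in S^dK^r$; for $r\le \dim V$ it is also identified with $u_1^d+\dots+u_r^d\in S^dV$ for any linearly independent $u_1,\dots,u_r\in V$ (the orbit $\operatorname{GL}(V)\cdot I_r$ does not depend on the choice). The symmetric subrank is $Q_s(f)=\max\{r\mid\exists\text{ linear }\varphi:V\to K^r,\ \varphi f=I_r\}$. The symmetric Hilbert–Mumford subrank is \[Q_{\mathrm{HM},s}(f)=\max\{r\mid \exists\text{ homomorphism of algebraic groups }\lambda:\mathbb{G}_{\mathrm m}\to\operatorname{GL}(V):\ \lim_{t\to0}\lambda(t)\cdot f\in\operatorname{GL}(V)\cdot I_r\},\] where it is part of the condition that the limit exists, i.e. that $t\mapsto\lambda(t)\cdot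 f$ extends to a morphism $\mathbb{A}^1\to S^dV$, the limit being the value at $0$. *)

theory Defs
  imports
    "HOL-Library.Poly_Mapping"
    "HOL-Combinatorics.Permutations"
    "HOL-Computational_Algebra.Computational_Algebra"
begin

section \<open>Free vector spaces\<close>

text \<open>
  \<open>'x \<Rightarrow>\<^sub>0 'k\<close> is the \<open>'k\<close>-vector space with basis \<open>'x\<close>; \<open>free_on X\<close> is its subspace
  with basis \<open>X\<close>. The element \<open>Poly_Mapping.single x 1\<close> is the basis vector \<open>x\<close>.
\<close>

definition fscale :: "'k::field \<Rightarrow> ('x \<Rightarrow>\<^sub>0 'k) \<Rightarrow> ('x \<Rightarrow>\<^sub>0 'k)" where
  "fscale c F = Poly_Mapping.map ((*) c) F"

definition free_on :: "'x set \<Rightarrow> ('x \<Rightarrow>\<^sub>0 'k::field) set" where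
  "free_on X = {F. Poly_Mapping.keys F \<subseteq> X}"

definition free_map :: "('x \<Rightarrow> 'y) \<Rightarrow> ('x \<Rightarrow>\<^sub>0 'k::field) \<Rightarrow> ('y \<Rightarrow>\<^sub>0 'k)" where
  "free_map h F = (\<Sum>x\<in>Poly_Mapping.keys F. Poly_Mapping.single (h x) (Poly_Mapping.lookup F x))"

definition coord_space :: "nat \<Rightarrow> (nat \<Rightarrow>\<^sub>0 'k::field) set" where
  "coord_space r = free_on {..<r}"

definition coord_vec :: "nat \<Rightarrow> (nat \<Rightarrow>\<^sub>0 'k::field)" where
  "coord_vec i = Poly_Mapping.single i 1"

section \<open>Symmetric powers\<close>

text \<open>
  Throughout, \<open>W\<close> is a linear subspace of an ambient vector space with scalar multiplication
  \<open>scale\<close>. The tensor power of \<open>W\<close> is the free vector space on \<open>d\<close>-tuples of elements of \<open>W\<close>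
  modulo the multilinearity relations, and the symmetric power is the quotient of the tensor power
  by the span of all \<open>T - \<sigma>(T)\<close>. The two quotients are taken in one go: \<open>S\<^sup>d W\<close> consists of the cosets
  of \<open>sym_null scale W d\<close> in the free vector space.
\<close>

definition tuples :: "'v set \<Rightarrow> nat \<Rightarrow> 'v list set" where
  "tuples W d = {xs. length xs = d \<and> set xs \<subseteq> W}"

definition formal_tensors :: "'v set \<Rightarrow> nat \<Rightarrow> ('v list \<Rightarrow>\<^sub>0 'k::field) set" where
  "formal_tensors W d = free_on (tuples W d)"

definition multilinear_rels ::
    "('k::field \<Rightarrow> 'v::ab_group_add \<Rightarrow> 'v) \<Rightarrow> 'v set \<Rightarrow> nat \<Rightarrow> ('v list \<Rightarrow>\<^sub>0 'k) set" where
  "multilinear_rels scale W d =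
     {Poly_Mapping.single (xs @ (v + w) # ys) 1
        - Poly_Mapping.single (xs @ v # ys) 1 - Poly_Mapping.single (xs @ w # ys) 1 | xs v w ys.
        xs @ v # ys \<in> tuples W d \<and> w \<in> W}
   \<union> {Poly_Mapping.single (xs @ scale c v # ys) 1 - Poly_Mapping.single (xs @ v # ys) c | xs c v ys.
        xs @ v # ys \<in> tuples W d}"

definition permutation_rels :: "'v set \<Rightarrow> nat \<Rightarrow> ('v list \<Rightarrow>\<^sub>0 'k::field) set" where
  "permutation_rels W d =
     {T - free_map (permute_list \<sigma>) T | T \<sigma>. T \<in> formal_tensors W d \<and> \<sigma> permutes {..<d}}"

definition sym_null ::
    "('k::field \<Rightarrow> 'v::ab_group_add \<Rightarrow> 'v) \<Rightarrow> 'v set \<Rightarrow> nat \<Rightarrow> ('v list \<Rightarrow>\<^sub>0 'k) set" where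
  "sym_null scale W d =
     module.span fscale (multilinear_rels scale W d \<union> permutation_rels W d)"

definition sym_class ::
    "('k::field \<Rightarrow> 'v::ab_group_add \<Rightarrow> 'v) \<Rightarrow> 'v set \<Rightarrow> nat \<Rightarrow> ('v list \<Rightarrow>\<^sub>0 'k) \<Rightarrow> ('v list \<Rightarrow>\<^sub>0 'k) set" where
  "sym_class scale W d T = {T'. T' - T \<in> sym_null scale W d}"

definition sym_power ::
    "('k::field \<Rightarrow> 'v::ab_group_add \<Rightarrow> 'v) \<Rightarrow> 'v set \<Rightarrow> nat \<Rightarrow> ('v list \<Rightarrow>\<^sub>0 'k) set set" where
  "sym_power scale W d = sym_class scale W d ` formal_tensors W d"

text \<open>
  The map \<open>S\<^sup>d W \<rightarrow> S\<^sup>d W'\<close> induced by a linear map \<open>\<phi> : W \<rightarrow> W'\<close>, where \<open>scale'\<close> and \<open>W'\<close> belong to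
  the target; see \<open>sym_map_class\<close> below for well-definedness.
\<close>

definition sym_map ::
    "('k::field \<Rightarrow> 'w::ab_group_add \<Rightarrow> 'w) \<Rightarrow> 'w set \<Rightarrow> nat \<Rightarrow> ('v \<Rightarrow> 'w)
      \<Rightarrow> ('v list \<Rightarrow>\<^sub>0 'k) set \<Rightarrow> ('w list \<Rightarrow>\<^sub>0 'k) set" where
  "sym_map scale' W' d \<phi> f = (\<Union>T\<in>f. sym_class scale' W' d (free_map (map \<phi>) T))"

definition power_sum ::
    "('k::field \<Rightarrow> 'v::ab_group_add \<Rightarrow> 'v) \<Rightarrow> 'v set \<Rightarrow> nat \<Rightarrow> nat \<Rightarrow> (nat \<Rightarrow> 'v) \<Rightarrow> ('v list \<Rightarrow>\<^sub>0 'k) set" where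
  "power_sum scale W d r u =
     sym_class scale W d (\<Sum>i<r. Poly_Mapping.single (replicate d (u i)) 1)"

definition unit_tensor :: "nat \<Rightarrow> nat \<Rightarrow> ((nat \<Rightarrow>\<^sub>0 'k::field) list \<Rightarrow>\<^sub>0 'k) set" where
  "unit_tensor d r = power_sum fscale (coord_space r) d r coord_vec"

section \<open>The symmetric subrank\<close>

definition sym_subrank ::
    "('k::field \<Rightarrow> 'v::ab_group_add \<Rightarrow> 'v) \<Rightarrow> nat \<Rightarrow> ('v list \<Rightarrow>\<^sub>0 'k) set \<Rightarrow> nat" where
  "sym_subrank scale d f =
     Max {r. \<exists>\<phi>. Vector_Spaces.linear scale fscale \<phi> \<and> range \<phi> \<subseteq> coord_space r
                 \<and> sym_map fscale (coord_space r) d \<phi> f = unit_tensor d r}"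

section \<open>The symmetric Hilbert--Mumford subrank\<close>

definition general_linear :: "('k::field \<Rightarrow> 'v::ab_group_add \<Rightarrow> 'v) \<Rightarrow> ('v \<Rightarrow> 'v) set" where
  "general_linear scale = {g. Vector_Spaces.linear scale scale g \<and> bij g}"

text \<open>
  Over an algebraically closed field a homomorphism of algebraic groups from the multiplicative
  group to \<open>GL(V)\<close> is a group homomorphism on points that is a Laurent polynomial in \<open>t\<close>
  with coefficients in \<open>End(V)\<close>. The value at \<open>t = 0\<close> is irrelevant.
\<close>

definition one_param_subgroup ::
    "('k::field \<Rightarrow> 'v::ab_group_add \<Rightarrow> 'v) \<Rightarrow> ('k \<Rightarrow> 'v \<Rightarrow> 'v) \<Rightarrow> bool" where
  "one_param_subgroup scale \<gamma> \<longleftrightarrow>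
     (\<forall>t. t \<noteq> 0 \<longrightarrow> \<gamma> t \<in> general_linear scale) \<and>
     (\<forall>s t. s \<noteq> 0 \<longrightarrow> t \<noteq> 0 \<longrightarrow> \<gamma> (s * t) = \<gamma> s \<circ> \<gamma> t) \<and>
     (\<exists>(I::int set) A. finite I \<and> (\<forall>i\<in>I. Vector_Spaces.linear scale scale (A i)) \<and>
        (\<forall>t v. t \<noteq> 0 \<longrightarrow> \<gamma> t v = (\<Sum>i\<in>I. scale (t powi i) (A i v))))"

text \<open>
  Morphisms from the affine line to \<open>S\<^sup>d W\<close>: polynomials in \<open>t\<close> with coefficients in \<open>S\<^sup>d W\<close>,
  the coefficients being given by representatives.
\<close>

definition affine_line_morphism ::
    "('k::field \<Rightarrow> 'v::ab_group_add \<Rightarrow> 'v) \<Rightarrow> 'v set \<Rightarrow> nat \<Rightarrow> ('k \<Rightarrow> ('v list \<Rightarrow>\<^sub>0 'k) set) \<Rightarrow> bool" where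
  "affine_line_morphism scale W d h \<longleftrightarrow>
     (\<exists>n T. (\<forall>i\<le>n. T i \<in> formal_tensors W d) \<and>
        (\<forall>t. h t = sym_class scale W d (\<Sum>i\<le>(n::nat). fscale (t ^ i) (T i))))"

definition has_limit_at_0 ::
    "('k::field \<Rightarrow> 'v::ab_group_add \<Rightarrow> 'v) \<Rightarrow> 'v set \<Rightarrow> nat
      \<Rightarrow> ('k \<Rightarrow> ('v list \<Rightarrow>\<^sub>0 'k) set) \<Rightarrow> ('v list \<Rightarrow>\<^sub>0 'k) set \<Rightarrow> bool" where
  "has_limit_at_0 scale W d c L \<longleftrightarrow>
     (\<exists>h. affine_line_morphism scale W d h \<and> (\<forall>t. t \<noteq> 0 \<longrightarrow> h t = c t) \<and> h 0 = L)"

text \<open>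
  The orbit \<open>GL(V) \<cdot> I\<^sub>r\<close> in \<open>S\<^sup>d V\<close>, where \<open>V\<close> is the whole type; it is empty for \<open>r > dim V\<close>.
\<close>

definition unit_orbit ::
    "('k::field \<Rightarrow> 'v::ab_group_add \<Rightarrow> 'v) \<Rightarrow> nat \<Rightarrow> nat \<Rightarrow> ('v list \<Rightarrow>\<^sub>0 'k) set set" where
  "unit_orbit scale d r =
     {sym_map scale UNIV d g (power_sum scale UNIV d r u) | g u.
        g \<in> general_linear scale \<and> inj_on u {..<r} \<and> \<not> module.dependent scale (u ` {..<r})}"

definition sym_HM_subrank ::
    "('k::field \<Rightarrow> 'v::ab_group_add \<Rightarrow> 'v) \<Rightarrow> nat \<Rightarrow> ('v list \<Rightarrow>\<^sub>0 'k) set \<Rightarrow> nat" where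
  "sym_HM_subrank scale d f =
     Max {r. \<exists>\<gamma>. one_param_subgroup scale \<gamma> \<and>
            (\<exists>L\<in>unit_orbit scale d r.
               has_limit_at_0 scale UNIV d (\<lambda>t. sym_map scale UNIV d (\<gamma> t) f) L)}"

definition characteristic_exponent :: "'k::field itself \<Rightarrow> nat" where
  "characteristic_exponent _ = (if CHAR('k) = 0 then 1 else CHAR('k))"

section \<open>Well-definedness of the induced map\<close>

lemma lookup_fscale [simp]: "Poly_Mapping.lookup (fscale c F) x = c * Poly_Mapping.lookup F x"
  by (simp add: fscale_def Poly_Mapping.map.rep_eq when_def)

lemma fscale_single: "fscale c (Poly_Mapping.single x a) = Poly_Mapping.single x (c * a)"
  by (simp add: fscale_def)

lemma vector_space_fscale: "vector_space (fscale :: 'k::field \<Rightarrow> ('x \<Rightarrow>\<^sub>0 'k) \<Rightarrow> _)"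
  by unfold_locales (auto intro!: poly_mapping_eqI simp: lookup_add algebra_simps)

interpretation fs: vector_space fscale
  by (rule vector_space_fscale)

lemma free_map_eq_sum:
  assumes "finite A" "Poly_Mapping.keys F \<subseteq> A"
  shows "free_map h F = (\<Sum>x\<in>A. Poly_Mapping.single (h x) (Poly_Mapping.lookup F x))"
  unfolding free_map_def
  by (rule sum.mono_neutral_left) (use assms in \<open>auto simp: in_keys_iff\<close>)

lemma free_map_add: "free_map h (F + G) = free_map h F + free_map h G"
proof -
  let ?A = "Poly_Mapping.keys F \<union> Poly_Mapping.keys G"
  have "Poly_Mapping.keys (F + G) \<subseteq> ?A" by (rule Poly_Mapping.keys_add)
  thus ?thesis
    by (simp add: free_map_eq_sum[of ?A] lookup_add single_add sum.distrib)
qed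

lemma free_map_fscale: "free_map h (fscale c F) = fscale c (free_map h F)"
proof -
  have "Poly_Mapping.keys (fscale c F) \<subseteq> Poly_Mapping.keys F"
    by (auto simp: in_keys_iff)
  thus ?thesis
    by (subst (1 2) free_map_eq_sum[of "Poly_Mapping.keys F"])
       (auto simp: fscale_single fs.scale_sum_right)
qed

lemma linear_free_map: "Vector_Spaces.linear fscale fscale (free_map h)"
  by unfold_locales (simp_all add: free_map_add free_map_fscale)

lemma free_map_diff: "free_map h (F - G) = free_map h F - free_map h G"
  by (metis add_diff_cancel diff_add_cancel free_map_add)

lemma free_map_single [simp]: "free_map h (Poly_Mapping.single x c) = Poly_Mapping.single (h x) c"
  by (cases "c = 0") (simp_all add: free_map_def)

lemma free_map_sum: "free_map h (sum F A) = (\<Sum>x\<in>A. free_map h (F x))"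
proof (induction A rule: infinite_finite_induct)
  case (insert x A) thus ?case by (simp add: free_map_add)
qed (simp_all add: free_map_def)

lemma free_map_free_map: "free_map g (free_map h F) = free_map (g \<circ> h) F"
  by (simp add: free_map_def[of h F] free_map_sum) (simp add: free_map_def)

lemma free_map_cong: "(\<And>x. x \<in> Poly_Mapping.keys F \<Longrightarrow> g x = h x) \<Longrightarrow> free_map g F = free_map h F"
  by (simp add: free_map_def)

lemma free_map_in_free_on: "F \<in> free_on X \<Longrightarrow> h ` X \<subseteq> Y \<Longrightarrow> free_map h F \<in> free_on Y"
  unfolding free_on_def free_map_def
  by (fastforce dest!: subsetD[OF Poly_Mapping.keys_sum] split: if_splits)

lemma free_map_sym_null:
  fixes \<phi> :: "'v::ab_group_add \<Rightarrow> 'w::ab_group_add"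
  assumes lin: "Vector_Spaces.linear scale scale' \<phi>" and W: "\<phi> ` W \<subseteq> W'"
    and T: "T \<in> sym_null scale W d"
  shows "free_map (map \<phi>) T \<in> sym_null scale' W' d"
proof -
  interpret Vector_Spaces.linear scale scale' \<phi> by (rule lin)
  interpret L: Vector_Spaces.linear fscale fscale "free_map (map \<phi>)" by (rule linear_free_map)
  let ?R = "\<lambda>s W. multilinear_rels s W d \<union> permutation_rels W d"
  have tup: "map \<phi> xs \<in> tuples W' d" if "xs \<in> tuples W d" for xs
    using that W by (auto simp: tuples_def)
  have "free_map (map \<phi>) ` ?R scale W \<subseteq> ?R scale' W'"
  proof (rule image_subsetI)
    fix R assume "R \<in> ?R scale W"
    then consider
        (a) xs v w ys where "xs @ v # ys \<in> tuples W d" "w \<in> W"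
          "R = Poly_Mapping.single (xs @ (v + w) # ys) 1
             - Poly_Mapping.single (xs @ v # ys) 1 - Poly_Mapping.single (xs @ w # ys) 1"
      | (b) xs c v ys where "xs @ v # ys \<in> tuples W d"
          "R = Poly_Mapping.single (xs @ scale c v # ys) 1 - Poly_Mapping.single (xs @ v # ys) c"
      | (c) T \<sigma> where "T \<in> formal_tensors W d" "\<sigma> permutes {..<d}"
          "R = T - free_map (permute_list \<sigma>) T"
      unfolding multilinear_rels_def permutation_rels_def by blast
    thus "free_map (map \<phi>) R \<in> ?R scale' W'"
    proof cases
      case a
      have "free_map (map \<phi>) R \<in> multilinear_rels scale' W' d"
        unfolding multilinear_rels_def
        apply (rule UnI1, rule CollectI)
        apply (rule exI[of _ "map \<phi> xs"], rule exI[of _ "\<phi> v"],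
               rule exI[of _ "\<phi> w"], rule exI[of _ "map \<phi> ys"])
        using a tup[OF a(1)] W by (auto simp: free_map_diff add)
      thus ?thesis by blast
    next
      case b
      have "free_map (map \<phi>) R \<in> multilinear_rels scale' W' d"
        unfolding multilinear_rels_def
        apply (rule UnI2, rule CollectI)
        apply (rule exI[of _ "map \<phi> xs"], rule exI[of _ c],
               rule exI[of _ "\<phi> v"], rule exI[of _ "map \<phi> ys"])
        using b tup[OF b(1)] by (auto simp: free_map_diff scale)
      thus ?thesis by blast
    next
      case c
      have "free_map (map \<phi>) (free_map (permute_list \<sigma>) T)
              = free_map (permute_list \<sigma>) (free_map (map \<phi>) T)"
        unfolding free_map_free_map
      proof (rule free_map_cong)
        fix xs assume "xs \<in> Poly_Mapping.keys T"
        hence "length xs = d"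
          using c(1) by (auto simp: formal_tensors_def free_on_def tuples_def)
        thus "(map \<phi> \<circ> permute_list \<sigma>) xs = (permute_list \<sigma> \<circ> map \<phi>) xs"
          using permute_list_map[of \<sigma> xs \<phi>] c(2) by simp
      qed
      moreover have "free_map (map \<phi>) T \<in> formal_tensors W' d"
        using c(1) tup unfolding formal_tensors_def by (blast intro: free_map_in_free_on)
      ultimately have "free_map (map \<phi>) R \<in> permutation_rels W' d"
        unfolding permutation_rels_def using c by (auto simp: free_map_diff)
      thus ?thesis by blast
    qed
  qed
  hence "fs.span (free_map (map \<phi>) ` ?R scale W) \<subseteq> fs.span (?R scale' W')"
    by (rule fs.span_mono)
  thus ?thesis
    using T L.span_image[of "?R scale W"] unfolding sym_null_def by blast
qed

lemma sym_class_eq_iff: "sym_class scale W d T = sym_class scale W d T' \<longleftrightarrow> T - T' \<in> sym_null scale W d"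
proof
  assume "sym_class scale W d T = sym_class scale W d T'"
  moreover have "T \<in> sym_class scale W d T"
    by (simp add: sym_class_def sym_null_def fs.span_zero)
  ultimately show "T - T' \<in> sym_null scale W d" by (auto simp: sym_class_def)
next
  assume D: "T - T' \<in> sym_null scale W d"
  have "x - T \<in> sym_null scale W d \<longleftrightarrow> x - T' \<in> sym_null scale W d" for x
    using D fs.span_add[of "x - T" _ "T - T'"] fs.span_diff[of "x - T'" _ "T - T'"]
    unfolding sym_null_def by auto
  thus "sym_class scale W d T = sym_class scale W d T'"
    by (auto simp: sym_class_def)
qed

lemma sym_map_class:
  assumes lin: "Vector_Spaces.linear scale scale' \<phi>" and W: "\<phi> ` W \<subseteq> W'"
  shows "sym_map scale' W' d \<phi> (sym_class scale W d T) = sym_class scale' W' d (free_map (map \<phi>) T)"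
proof -
  have "sym_class scale' W' d (free_map (map \<phi>) T') = sym_class scale' W' d (free_map (map \<phi>) T)"
    if "T' \<in> sym_class scale W d T" for T'
    unfolding sym_class_eq_iff free_map_diff[symmetric]
    using free_map_sym_null[OF lin W, of "T' - T" d] that by (simp add: sym_class_def)
  moreover have "T \<in> sym_class scale W d T"
    by (simp add: sym_class_def sym_null_def fs.span_zero)
  ultimately show ?thesis unfolding sym_map_def by blast
qed

end

theory Submission
  imports Defs
begin

text \<open>
  The two subranks are maxima of the same set of numbers \<open>r\<close>: a linear map \<open>\<phi>\<close> with
  \<open>\<phi> f = I\<^sub>r\<close> can be turned into a one-parameter subgroup with limit in the orbit of \<open>I\<^sub>r\<close>,
  and conversely. Write \<open>d = q m\<close>, where \<open>q\<close> is a power of the characteristic exponent and \<open>m\<close> is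
  invertible in \<open>K\<close>; the hypothesis on \<open>d\<close> says that \<open>m \<ge> 3\<close>. A symmetric
  tensor has a well-defined value at every linear functional on \<open>V\<close> (\<open>tensor_eval\<close>), and these values
  give all the necessary conditions for an equality of symmetric tensors that are used. At a functional
  \<open>\<alpha>\<close>, a sum \<open>u\<^sub>1\<^sup>d + \<dots> + u\<^sub>r\<^sup>d\<close> takes the value \<open>\<Sum>\<^sub>j \<alpha>(u\<^sub>j)\<^sup>d\<close>, which by Frobenius is the \<open>q\<close>-th
  power of \<open>\<Sum>\<^sub>j \<alpha>(u\<^sub>j)\<^sup>m\<close>. Hence equalities between such values can be differentiated in a direction
  \<open>\<beta>\<close> as if the exponent were \<open>m\<close>, which gives equalities of the expressions
  \<open>F(\<beta>, \<alpha>) = \<Sum>\<^sub>j \<beta>(u\<^sub>j) \<alpha>(u\<^sub>j)\<^bsup>m-1\<^esup>\<close> (\<open>power_sum_derivative\<close>).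

  From \<open>\<phi>\<close> to a one-parameter subgroup (\<open>subrank_imp_HM\<close>). If \<open>\<phi> f = I\<^sub>r\<close>, then \<open>\<phi>\<close> maps onto
  \<open>K\<^sup>r\<close>: a functional vanishing on the image of \<open>\<phi>\<close> is a direction in which the polynomial function
  \<open>I\<^sub>r\<close> is constant, and differentiating shows that this functional is zero
  (\<open>unit_tensor_image_imp_onto\<close>). So \<open>\<phi>\<close> has a section \<open>s\<close>, and \<open>\<pi> = s \<circ> \<phi>\<close> is a projection.
  The subgroup acting as the identity on the image of \<open>\<pi>\<close> and as multiplication by \<open>t\<close> on its
  kernel carries \<open>f\<close> to the limit \<open>\<pi> f = s(I\<^sub>r)\<close>, a sum of powers of independent vectors.

  From a one-parameter subgroup \<open>\<gamma>\<close> to \<open>\<phi>\<close> (\<open>HM_imp_subrank\<close>). Let \<open>A\<^sub>i\<close> be the projection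
  onto the \<open>i\<close>-th weight space, and suppose that \<open>\<gamma>(t) f\<close> tends to \<open>w\<^sub>1\<^sup>d + \<dots> + w\<^sub>r\<^sup>d\<close> with
  independent \<open>w\<^sub>j\<close>. The limit is fixed by \<open>\<gamma>\<close>. Therefore \<open>F\<close>, formed with the \<open>w\<^sub>j\<close>, vanishes
  on functionals \<open>\<beta>\<close> of weight \<open>a\<close> and \<open>\<alpha>\<close> of weight \<open>b\<close> unless \<open>a + (m-1) b = 0\<close>. As the \<open>w\<^sub>j\<close> are
  independent, \<open>F(\<beta>, \<alpha>) \<noteq> 0\<close> for some \<open>\<beta>\<close> as soon as \<open>\<alpha>\<close> does not vanish on all \<open>w\<^sub>j\<close>.
  So if a weight \<open>b\<close> occurs in the \<open>w\<^sub>j\<close>, then so does \<open>-(m-1) b\<close>; since \<open>m - 1 \<ge> 2\<close>, iterating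
  would give infinitely many weights unless \<open>b = 0\<close> (\<open>fixes_power_sum_imp_weight_zero\<close>). Hence
  \<open>A\<^sub>0 w\<^sub>j = w\<^sub>j\<close>. Since \<open>A\<^sub>0 \<circ> \<gamma>(t) = A\<^sub>0\<close>, the tensor \<open>A\<^sub>0 f\<close> equals \<open>A\<^sub>0\<close> applied to the limit,
  which is the limit itself, and \<open>\<phi>\<close> is \<open>A\<^sub>0\<close> followed by a linear map sending \<open>w\<^sub>j\<close> to \<open>e\<^sub>j\<close>.
\<close>

section \<open>Linear functionals and Laurent polynomials\<close>

lemma vector_space_field: "vector_space ((*) :: 'k::field \<Rightarrow> 'k \<Rightarrow> 'k)"
  by unfold_locales (simp_all add: algebra_simps)

lemma infinite_UNIV_alg_closed: "infinite (UNIV :: 'k::alg_closed_field set)"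
proof
  assume fin: "finite (UNIV :: 'k set)"
  \<comment> \<open>Euclid's argument: this polynomial takes the value 1 everywhere.\<close>
  define P :: "'k poly" where "P = (\<Prod>a\<in>UNIV. [:-a, 1:]) + 1"
  have "poly P x = 1" for x
    using fin by (auto simp: P_def poly_prod)
  moreover have "degree (\<Prod>a\<in>(UNIV::'k set). [:-a, 1:]) = card (UNIV :: 'k set)"
    using fin by (subst degree_prod_eq_sum_degree) auto
  hence "degree (\<Prod>a\<in>(UNIV::'k set). [:-a, 1:]) > 0"
    using fin by (simp add: card_gt_0_iff)
  hence "degree P > 0"
    unfolding P_def by (subst degree_add_eq_left) auto
  ultimately show False
    using alg_closed_imp_poly_has_root[of P] by auto
qed

lemma poly_eq_if_eq_off_zero:
  fixes P Q :: "'k::alg_closed_field poly"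
  assumes "\<And>t. t \<noteq> 0 \<Longrightarrow> poly P t = poly Q t"
  shows "P = Q"
proof (rule ccontr)
  assume "P \<noteq> Q"
  hence "finite {t. poly (P - Q) t = 0}"
    by (intro poly_roots_finite) simp
  moreover have "UNIV \<subseteq> insert 0 {t. poly (P - Q) t = 0}"
    using assms by auto
  ultimately show False
    using infinite_UNIV_alg_closed finite_subset by blast
qed

text \<open>This lemma turns membership in a subspace, in particular equality of classes in a symmetric
  power, into statements about scalars.\<close>

lemma separating_functional:
  fixes scale :: "'k::field \<Rightarrow> 'v::ab_group_add \<Rightarrow> 'v"
  assumes vs: "vector_space scale" and N: "module.subspace scale N" and v: "v \<notin> N"
  obtains l where "Vector_Spaces.linear scale (*) l" "\<And>x. x \<in> N \<Longrightarrow> l x = 0" "l v = 1"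
proof -
  interpret V: vector_space scale by (rule vs)
  interpret K: vector_space "(*) :: 'k \<Rightarrow> 'k \<Rightarrow> 'k" by (rule vector_space_field)
  interpret P: vector_space_pair scale "(*) :: 'k \<Rightarrow> 'k \<Rightarrow> 'k" ..
  obtain B where B: "B \<subseteq> N" "V.independent B" "N \<subseteq> V.span B"
    using V.maximal_independent_subset[of N] .
  have "V.span B \<subseteq> N"
    using B(1) N by (rule V.span_minimal)
  hence "v \<notin> V.span B" using v by blast
  hence "V.independent (insert v B)"
    using B(2) by (rule V.independent_insertI)
  then obtain l where l: "Vector_Spaces.linear scale (*) l"
      "\<forall>x\<in>insert v B. l x = (if x = v then 1 else 0)"
    using P.linear_independent_extend[of "insert v B" "\<lambda>x. if x = v then 1 else 0"] by blast
  have "l x = 0" if "x \<in> B" for x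
    using l(2) B(1) v that by auto
  hence "l x = 0" if "x \<in> N" for x
    using P.linear_eq_0_on_span[OF l(1), of B x] B(3) that by blast
  thus thesis using that l by auto
qed

lemma scalar_laurent_vanishing:
  fixes c :: "int \<Rightarrow> 'k::alg_closed_field"
  assumes I: "finite I" and van: "\<And>t. t \<noteq> 0 \<Longrightarrow> (\<Sum>i\<in>I. t powi i * c i) = 0" and j: "j \<in> I"
  shows "c j = 0"
proof -
  \<comment> \<open>Multiplying by \<open>t\<^sup>N\<close> clears all negative exponents.\<close>
  define N where "N = (\<Sum>i\<in>I. \<bar>i\<bar>)"
  have N: "0 \<le> i + N" if "i \<in> I" for i
    using member_le_sum[of i I "\<lambda>i. \<bar>i\<bar>"] that I by (auto simp: N_def)
  define P where "P = (\<Sum>i\<in>I. monom (c i) (nat (i + N)))"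
  have "poly P t = poly 0 t" if "t \<noteq> 0" for t
  proof -
    have "poly P t = (\<Sum>i\<in>I. t powi N * (t powi i * c i))"
      unfolding P_def poly_sum
    proof (rule sum.cong)
      fix i assume "i \<in> I"
      hence "t ^ nat (i + N) = t powi (i + N)"
        using N by (simp add: power_int_def)
      thus "poly (monom (c i) (nat (i + N))) t = t powi N * (t powi i * c i)"
        using that by (simp add: poly_monom power_int_add)
    qed simp
    thus ?thesis using van[OF that] by (simp flip: sum_distrib_left)
  qed
  hence "P = 0" by (rule poly_eq_if_eq_off_zero)
  moreover have "coeff P (nat (j + N)) = (\<Sum>i\<in>I. if i = j then c i else 0)"
    unfolding P_def coeff_sum using N j by (intro sum.cong) (auto simp: nat_eq_iff)
  ultimately show ?thesis using I j by simp
qed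

text \<open>Comparison of coefficients in a quotient space. For the subspace \<open>{0}\<close> it yields the weight
  projections of a one-parameter subgroup; for the relations defining a symmetric power it
  identifies the coefficients of a family of symmetric tensors.\<close>

lemma laurent_vanishing_mod_subspace:
  fixes scale :: "'k::alg_closed_field \<Rightarrow> 'v::ab_group_add \<Rightarrow> 'v"
  assumes vs: "vector_space scale" and N: "module.subspace scale N" and I: "finite I"
    and van: "\<And>t. t \<noteq> 0 \<Longrightarrow> (\<Sum>i\<in>I. scale (t powi i) (v i)) \<in> N" and j: "j \<in> I"
  shows "v j \<in> N"
proof (rule ccontr)
  assume "v j \<notin> N"
  from separating_functional[OF vs N this] obtain l
    where l: "Vector_Spaces.linear scale (*) l" "\<And>x. x \<in> N \<Longrightarrow> l x = 0" "l (v j) = 1" by metis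
  interpret l: Vector_Spaces.linear scale "(*)" l by (rule l(1))
  have "(\<Sum>i\<in>I. t powi i * l (v i)) = 0" if "t \<noteq> 0" for t
    using l(2)[OF van[OF that]] by (simp add: l.sum l.scale)
  from scalar_laurent_vanishing[OF I this j] show False using l(3) by simp
qed

lemma polynomial_vanishing_mod_subspace:
  fixes scale :: "'k::alg_closed_field \<Rightarrow> 'v::ab_group_add \<Rightarrow> 'v"
  assumes vs: "vector_space scale" and N: "module.subspace scale N"
    and van: "\<And>t. t \<noteq> 0 \<Longrightarrow> (\<Sum>i\<le>n::nat. scale (t ^ i) (v i)) \<in> N" and j: "j \<le> n"
  shows "v j \<in> N"
proof -
  have "(\<Sum>i\<in>int ` {..n}. scale (t powi i) (v (nat i))) = (\<Sum>i\<le>n. scale (t ^ i) (v i))" for t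
    by (subst sum.reindex) (auto simp: inj_on_def)
  thus ?thesis
    using laurent_vanishing_mod_subspace[OF vs N, of "int ` {..n}" "\<lambda>i. v (nat i)" "int j"] van j
    by auto
qed

section \<open>Power sums and the Frobenius map\<close>

lemma characteristic_exponent_cases:
  obtains "characteristic_exponent TYPE('k::field) = 1" "CHAR('k) = 0"
  | "characteristic_exponent TYPE('k) = CHAR('k)" "prime CHAR('k)"
  using prime_CHAR_semidom[where 'a = 'k] unfolding characteristic_exponent_def by fastforce

lemma frobenius_sum:
  fixes x :: "'j \<Rightarrow> 'k::field"
  assumes q: "q = characteristic_exponent TYPE('k) ^ k"
  shows "sum x J ^ q = (\<Sum>j\<in>J. x j ^ q)"
  by (cases rule: characteristic_exponent_cases[where 'k = 'k])
     (simp_all add: q freshmans_dream_sum'[where n = k])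

lemma frobenius_inj:
  fixes x y :: "'k::field"
  assumes q: "q = characteristic_exponent TYPE('k) ^ k" and eq: "x ^ q = y ^ q"
  shows "x = y"
proof -
  \<comment> \<open>The two-term case of \<open>frobenius_sum\<close>, applied to \<open>x = y + (x - y)\<close>, gives \<open>(x - y)\<^sup>q = 0\<close>.\<close>
  have "x ^ q = (\<Sum>b\<in>{True, False}. if b then y else x - y) ^ q" by simp
  also have "\<dots> = y ^ q + (x - y) ^ q"
    unfolding frobenius_sum[OF q] by simp
  finally show ?thesis using eq by simp
qed

text \<open>The excluded exponents are \<open>0\<close> and those whose part prime to the characteristic is \<open>1\<close> or
  \<open>2\<close>; in characteristic \<open>0\<close> that part is \<open>d\<close> itself.\<close>

lemma prime_to_characteristic_part:
  assumes "\<not> (\<exists>c\<in>{0, 1, 2}. \<exists>k. d = c * characteristic_exponent TYPE('k::field) ^ k)"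
  obtains k m where "d = characteristic_exponent TYPE('k) ^ k * m" "of_nat m \<noteq> (0::'k)" "m \<ge> 3"
proof -
  let ?p = "characteristic_exponent TYPE('k)"
  have "\<exists>k m. d = ?p ^ k * m \<and> of_nat m \<noteq> (0::'k)"
  proof (cases rule: characteristic_exponent_cases[where 'k = 'k])
    case 1
    moreover have "d \<noteq> 0" using assms by auto
    ultimately show ?thesis
      by (intro exI[of _ 0] exI[of _ d]) (auto simp: of_nat_eq_0_iff_char_dvd)
  next
    case 2
    moreover have "d \<noteq> 0" using assms by auto
    ultimately obtain m where "d = CHAR('k) ^ multiplicity CHAR('k) d * m" "\<not> CHAR('k) dvd m"
      using multiplicity_decompose'[of d "CHAR('k)"] not_prime_unit by blast
    thus ?thesis using 2 by (auto simp: of_nat_eq_0_iff_char_dvd)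
  qed
  then obtain k m where km: "d = ?p ^ k * m" "of_nat m \<noteq> (0::'k)" by blast
  moreover have "m \<noteq> c" if "c \<in> {0, 1, 2}" for c
    using assms km(1) that by (metis mult.commute)
  hence "m \<noteq> 0" "m \<noteq> 1" "m \<noteq> 2" by auto
  ultimately show thesis by (intro that[of k m]) auto
qed

lemma pderiv_sum: "pderiv (sum P J) = (\<Sum>j\<in>J. pderiv (P j))"
  using higher_pderiv_sum[of 1 P J] by simp

text \<open>If \<open>d = q m\<close> with \<open>q\<close> a power of the characteristic exponent and \<open>m\<close> invertible in the field,
  then a sum of \<open>d\<close>-th powers is the \<open>q\<close>-th power of a sum of \<open>m\<close>-th powers. As the \<open>q\<close>-th power
  map is injective, an identity between sums of \<open>d\<close>-th powers can be differentiated as if the exponent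
  were \<open>m\<close>, where no information is lost.\<close>

lemma power_sum_derivative:
  fixes a b a' b' :: "'j \<Rightarrow> 'k::alg_closed_field"
  assumes d: "d = characteristic_exponent TYPE('k) ^ k * m" and m: "of_nat m \<noteq> (0::'k)"
    and eq: "\<And>x. (\<Sum>j\<in>J. (a j + x * b j) ^ d) = (\<Sum>j\<in>J. (a' j + x * b' j) ^ d)"
  shows "(\<Sum>j\<in>J. b j * a j ^ (m - 1)) = (\<Sum>j\<in>J. b' j * a' j ^ (m - 1))"
proof -
  let ?q = "characteristic_exponent TYPE('k) ^ k"
  define P where "P a b = (\<Sum>j\<in>J. [:a j, b j:] ^ m)" for a b :: "'j \<Rightarrow> 'k"
  have "poly (P a b) x ^ ?q = poly (P a' b') x ^ ?q" for x
    using eq[of x] unfolding d P_def poly_sum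
    by (simp add: frobenius_sum[OF refl] power_mult[symmetric] mult.commute[of m])
  hence PP: "P a b = P a' b'"
    by (intro poly_eq_if_eq_off_zero) (rule frobenius_inj[OF refl])
  have deriv: "poly (pderiv (P a b)) 0 = of_nat m * (\<Sum>j\<in>J. b j * a j ^ (m - 1))" for a b
    using m unfolding P_def pderiv_sum poly_sum sum_distrib_left
    by (intro sum.cong) (auto simp: pderiv_power pderiv_pCons poly_power mult_ac)
  show ?thesis
    using deriv[of a b] deriv[of a' b'] m unfolding PP by simp
qed

section \<open>Evaluating symmetric tensors at functionals\<close>

text \<open>Read as a polynomial function on the dual space, a tensor is evaluated at the functional
  \<open>\<alpha>\<close>. On representatives this is defined for all functions \<open>\<alpha>\<close>; it passes to
  symmetric tensors when \<open>\<alpha>\<close> is linear (\<open>tensor_eval_sym_null\<close>).\<close>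

definition tensor_eval :: "('v \<Rightarrow> 'k::field) \<Rightarrow> ('v list \<Rightarrow>\<^sub>0 'k) \<Rightarrow> 'k" where
  "tensor_eval \<alpha> T = (\<Sum>xs\<in>Poly_Mapping.keys T. Poly_Mapping.lookup T xs * prod_list (map \<alpha> xs))"

lemma tensor_eval_eq_sum:
  assumes "finite A" "Poly_Mapping.keys T \<subseteq> A"
  shows "tensor_eval \<alpha> T = (\<Sum>xs\<in>A. Poly_Mapping.lookup T xs * prod_list (map \<alpha> xs))"
  unfolding tensor_eval_def
  by (rule sum.mono_neutral_left) (use assms in \<open>auto simp: in_keys_iff\<close>)

lemma tensor_eval_add: "tensor_eval \<alpha> (S + T) = tensor_eval \<alpha> S + tensor_eval \<alpha> T"
proof -
  let ?A = "Poly_Mapping.keys S \<union> Poly_Mapping.keys T"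
  have "Poly_Mapping.keys (S + T) \<subseteq> ?A" by (rule Poly_Mapping.keys_add)
  thus ?thesis
    by (simp add: tensor_eval_eq_sum[of ?A] lookup_add sum.distrib algebra_simps)
qed

lemma tensor_eval_fscale: "tensor_eval \<alpha> (fscale c T) = c * tensor_eval \<alpha> T"
proof -
  have "Poly_Mapping.keys (fscale c T) \<subseteq> Poly_Mapping.keys T"
    by (auto simp: in_keys_iff)
  thus ?thesis
    by (subst (1 2) tensor_eval_eq_sum[of "Poly_Mapping.keys T"])
       (auto simp: sum_distrib_left mult_ac)
qed

lemma linear_tensor_eval: "Vector_Spaces.linear fscale (*) (tensor_eval \<alpha>)"
proof -
  interpret K: vector_space "(*) :: 'k::field \<Rightarrow> 'k \<Rightarrow> 'k" by (rule vector_space_field)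
  show ?thesis
    by unfold_locales (simp_all add: tensor_eval_add tensor_eval_fscale)
qed

lemma tensor_eval_diff: "tensor_eval \<alpha> (S - T) = tensor_eval \<alpha> S - tensor_eval \<alpha> T"
  by (metis add_diff_cancel diff_add_cancel tensor_eval_add)

lemma tensor_eval_single: "tensor_eval \<alpha> (Poly_Mapping.single xs c) = c * prod_list (map \<alpha> xs)"
  by (simp add: tensor_eval_def)

lemma tensor_eval_sum: "tensor_eval \<alpha> (sum T J) = (\<Sum>j\<in>J. tensor_eval \<alpha> (T j))"
proof (induction J rule: infinite_finite_induct)
  case (insert x A) thus ?case by (simp add: tensor_eval_add)
qed (simp_all add: tensor_eval_def)

lemma tensor_eval_free_map: "tensor_eval \<alpha> (free_map (map \<phi>) T) = tensor_eval (\<alpha> \<circ> \<phi>) T"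
  unfolding free_map_def tensor_eval_sum tensor_eval_single
  by (simp add: tensor_eval_def)

lemma tensor_eval_power_sum:
  "tensor_eval \<alpha> (\<Sum>j\<in>J. Poly_Mapping.single (replicate d (u j)) 1) = (\<Sum>j\<in>J. \<alpha> (u j) ^ d)"
  by (simp add: tensor_eval_sum tensor_eval_single prod_list_replicate)

lemma tensor_eval_sym_null:
  fixes scale :: "'k::field \<Rightarrow> 'v::ab_group_add \<Rightarrow> 'v"
  assumes lin: "Vector_Spaces.linear scale (*) \<alpha>" and T: "T \<in> sym_null scale W d"
  shows "tensor_eval \<alpha> T = 0"
proof -
  interpret \<alpha>: Vector_Spaces.linear scale "(*)" \<alpha> by (rule lin)
  interpret E: Vector_Spaces.linear fscale "(*)" "tensor_eval \<alpha>" by (rule linear_tensor_eval)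
  have "tensor_eval \<alpha> R = 0" if R: "R \<in> multilinear_rels scale W d" for R
  proof -
    consider (add) xs v w ys where
        "R = Poly_Mapping.single (xs @ (v + w) # ys) 1
           - Poly_Mapping.single (xs @ v # ys) 1 - Poly_Mapping.single (xs @ w # ys) 1"
      | (scale) xs c v ys where
        "R = Poly_Mapping.single (xs @ scale c v # ys) 1 - Poly_Mapping.single (xs @ v # ys) c"
      using R unfolding multilinear_rels_def by blast
    thus ?thesis
    proof cases
      case add
      show ?thesis
        unfolding add tensor_eval_diff tensor_eval_single
        by (simp add: \<alpha>.add distrib_left distrib_right)
    next
      case scale
      show ?thesis
        unfolding scale tensor_eval_diff tensor_eval_single
        by (simp add: \<alpha>.scale)
    qed
  qed
  moreover have "tensor_eval \<alpha> R = 0" if perm: "R \<in> permutation_rels W d" for R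
  proof -
    obtain T \<sigma> where R: "T \<in> formal_tensors W d" "\<sigma> permutes {..<d}"
        "R = T - free_map (permute_list \<sigma>) T"
      using perm unfolding permutation_rels_def by blast
    have "tensor_eval \<alpha> (free_map (permute_list \<sigma>) T)
            = (\<Sum>xs\<in>Poly_Mapping.keys T. Poly_Mapping.lookup T xs * prod_list (map \<alpha> (permute_list \<sigma> xs)))"
      by (simp add: free_map_def tensor_eval_sum tensor_eval_single)
    also have "\<dots> = tensor_eval \<alpha> T"
      unfolding tensor_eval_def
    proof (rule sum.cong)
      fix xs assume "xs \<in> Poly_Mapping.keys T"
      hence "length xs = d"
        using R(1) by (auto simp: formal_tensors_def free_on_def tuples_def)
      hence "mset (permute_list \<sigma> xs) = mset xs"
        using R(2) by simp
      hence "mset (map \<alpha> (permute_list \<sigma> xs)) = mset (map \<alpha> xs)"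
        by simp
      thus "Poly_Mapping.lookup T xs * prod_list (map \<alpha> (permute_list \<sigma> xs))
            = Poly_Mapping.lookup T xs * prod_list (map \<alpha> xs)"
        by (metis prod_mset_prod_list)
    qed simp
    finally show ?thesis by (simp add: R(3) tensor_eval_diff)
  qed
  ultimately have "tensor_eval \<alpha> R = 0" if "R \<in> multilinear_rels scale W d \<union> permutation_rels W d" for R
    using that by (elim UnE)
  thus ?thesis
    using T unfolding sym_null_def by (rule E.eq_0_on_span)
qed

lemma tensor_eval_cong_sym_null:
  assumes "Vector_Spaces.linear scale (*) \<alpha>" "S - T \<in> sym_null scale W d"
  shows "tensor_eval \<alpha> S = tensor_eval \<alpha> T"
  using tensor_eval_sym_null[OF assms] by (simp add: tensor_eval_diff)


lemma subspace_sym_null: "fs.subspace (sym_null scale W d)"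
  unfolding sym_null_def by (rule fs.subspace_span)

lemma subspace_free_on: "fs.subspace (free_on X :: ('x \<Rightarrow>\<^sub>0 'k::field) set)"
  unfolding fs.subspace_def free_on_def
  by (auto dest!: subsetD[OF Poly_Mapping.keys_add]) (auto simp: in_keys_iff)

lemma subspace_formal_tensors: "fs.subspace (formal_tensors W d :: ('v list \<Rightarrow>\<^sub>0 'k::field) set)"
  unfolding formal_tensors_def by (rule subspace_free_on)

section \<open>Polynomial families of symmetric tensors\<close>

lemma affine_line_morphism_class_iff:
  "affine_line_morphism scale W d (\<lambda>t. sym_class scale W d (F t)) \<longleftrightarrow>
     (\<exists>n T. (\<forall>i\<le>n. T i \<in> formal_tensors W d) \<and>
        (\<forall>t. F t - (\<Sum>i\<le>(n::nat). fscale (t ^ i) (T i)) \<in> sym_null scale W d))"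
  unfolding affine_line_morphism_def sym_class_eq_iff ..

lemma affine_line_morphism_const:
  assumes "T \<in> formal_tensors W d"
  shows "affine_line_morphism scale W d (\<lambda>t. sym_class scale W d T)"
  unfolding affine_line_morphism_class_iff
  by (intro exI[of _ 0] exI[of _ "\<lambda>_. T"]) (simp add: assms fs.subspace_0[OF subspace_sym_null])

lemma affine_line_morphism_add:
  fixes scale :: "'k::field \<Rightarrow> 'v::ab_group_add \<Rightarrow> 'v"
  assumes "affine_line_morphism scale W d (\<lambda>t. sym_class scale W d (F t))"
    and "affine_line_morphism scale W d (\<lambda>t. sym_class scale W d (G t))"
  shows "affine_line_morphism scale W d (\<lambda>t. sym_class scale W d (F t + G t))"
proof -
  obtain n T where T: "\<forall>i\<le>n. T i \<in> formal_tensors W d"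
      "\<forall>t. F t - (\<Sum>i\<le>n. fscale (t ^ i) (T i)) \<in> sym_null scale W d"
    using assms(1) unfolding affine_line_morphism_class_iff by blast
  obtain n' T' where T': "\<forall>i\<le>n'. T' i \<in> formal_tensors W d"
      "\<forall>t. G t - (\<Sum>i\<le>n'. fscale (t ^ i) (T' i)) \<in> sym_null scale W d"
    using assms(2) unfolding affine_line_morphism_class_iff by blast
  define N where "N = max n n'"
  have le: "n \<le> N" "n' \<le> N" by (simp_all add: N_def)
  define S where "S i = (if i \<le> n then T i else 0) + (if i \<le> n' then T' i else 0)" for i
  have pad: "(\<Sum>i\<le>N. fscale (t ^ i) (if i \<le> k then X i else 0)) = (\<Sum>i\<le>k. fscale (t ^ i) (X i))"
    if "k \<le> N" for k t and X :: "nat \<Rightarrow> ('v list \<Rightarrow>\<^sub>0 'k)"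
    using that by (intro sum.mono_neutral_cong_right) auto
  have "(\<Sum>i\<le>N. fscale (t ^ i) (S i))
          = (\<Sum>i\<le>n. fscale (t ^ i) (T i)) + (\<Sum>i\<le>n'. fscale (t ^ i) (T' i))" for t
    unfolding S_def fs.scale_right_distrib sum.distrib by (simp add: pad le)
  moreover have "S i \<in> formal_tensors W d" for i
    unfolding S_def using T(1) T'(1)
    by (intro fs.subspace_add[OF subspace_formal_tensors])
       (auto simp: fs.subspace_0[OF subspace_formal_tensors])
  moreover have "F t + G t - ((\<Sum>i\<le>n. fscale (t ^ i) (T i)) + (\<Sum>i\<le>n'. fscale (t ^ i) (T' i)))
      \<in> sym_null scale W d" for t
    using fs.subspace_add[OF subspace_sym_null T(2)[rule_format, of t] T'(2)[rule_format, of t]]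
    by (simp add: algebra_simps)
  ultimately show ?thesis
    unfolding affine_line_morphism_class_iff by (intro exI[of _ N] exI[of _ S]) simp
qed

lemma affine_line_morphism_fscale:
  assumes "affine_line_morphism scale W d (\<lambda>t. sym_class scale W d (F t))"
  shows "affine_line_morphism scale W d (\<lambda>t. sym_class scale W d (fscale c (F t)))"
proof -
  obtain n T where T: "\<forall>i\<le>n. T i \<in> formal_tensors W d"
      "\<forall>t. F t - (\<Sum>i\<le>n. fscale (t ^ i) (T i)) \<in> sym_null scale W d"
    using assms unfolding affine_line_morphism_class_iff by blast
  have "fscale c (F t) - (\<Sum>i\<le>n. fscale (t ^ i) (fscale c (T i))) \<in> sym_null scale W d" for t
    using fs.subspace_scale[OF subspace_sym_null T(2)[rule_format, of t], of c]
    by (simp add: fs.scale_right_diff_distrib fs.scale_sum_right mult.commute)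
  thus ?thesis
    unfolding affine_line_morphism_class_iff
    using T(1) fs.subspace_scale[OF subspace_formal_tensors]
    by (intro exI[of _ n] exI[of _ "\<lambda>i. fscale c (T i)"]) blast
qed

lemma affine_line_morphism_fscale_parameter:
  assumes "affine_line_morphism scale W d (\<lambda>t. sym_class scale W d (F t))"
  shows "affine_line_morphism scale W d (\<lambda>t. sym_class scale W d (fscale t (F t)))"
proof -
  obtain n T where T: "\<forall>i\<le>n. T i \<in> formal_tensors W d"
      "\<forall>t. F t - (\<Sum>i\<le>n. fscale (t ^ i) (T i)) \<in> sym_null scale W d"
    using assms unfolding affine_line_morphism_class_iff by blast
  \<comment> \<open>multiplication by \<open>t\<close> shifts the coefficients by one\<close>
  define S where "S i = (case i of 0 \<Rightarrow> 0 | Suc i \<Rightarrow> T i)" for i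
  have "fscale t (F t) - (\<Sum>i\<le>Suc n. fscale (t ^ i) (S i)) \<in> sym_null scale W d" for t
    using fs.subspace_scale[OF subspace_sym_null T(2)[rule_format, of t], of t]
    unfolding sum.atMost_Suc_shift
    by (simp add: S_def fs.scale_right_diff_distrib fs.scale_sum_right)
  moreover have "\<forall>i\<le>Suc n. S i \<in> formal_tensors W d"
    using T(1) by (auto simp: S_def fs.subspace_0[OF subspace_formal_tensors] split: nat.split)
  ultimately show ?thesis
    unfolding affine_line_morphism_class_iff by blast
qed

lemma affine_line_morphism_sum:
  assumes "\<And>x. x \<in> X \<Longrightarrow> affine_line_morphism scale W d (\<lambda>t. sym_class scale W d (F x t))"
  shows "affine_line_morphism scale W d (\<lambda>t. sym_class scale W d (\<Sum>x\<in>X. F x t))"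
  using assms
  by (induction X rule: infinite_finite_induct)
     (simp_all add: affine_line_morphism_const affine_line_morphism_add
       fs.subspace_0[OF subspace_formal_tensors])

lemma tensor_add_in_sym_null:
  assumes "Suc (length xs + length ys) = d"
  shows "Poly_Mapping.single (xs @ (v + w) # ys) 1
       - Poly_Mapping.single (xs @ v # ys) 1 - Poly_Mapping.single (xs @ w # ys) 1
     \<in> sym_null scale UNIV d"
  unfolding sym_null_def multilinear_rels_def tuples_def
  by (rule fs.span_base, rule UnI1, rule UnI1, rule CollectI,
      intro exI[of _ xs] exI[of _ v] exI[of _ w] exI[of _ ys]) (use assms in simp)

lemma tensor_scale_in_sym_null:
  assumes "Suc (length xs + length ys) = d"
  shows "Poly_Mapping.single (xs @ scale c v # ys) 1 - Poly_Mapping.single (xs @ v # ys) c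
     \<in> sym_null scale UNIV d"
  unfolding sym_null_def multilinear_rels_def tuples_def
  by (rule fs.span_base, rule UnI1, rule UnI2, rule CollectI,
      intro exI[of _ xs] exI[of _ c] exI[of _ v] exI[of _ ys]) (use assms in simp)

text \<open>Expanding a product of vectors \<open>P v + t Q v\<close> factor by factor shows that it is polynomial
  in \<open>t\<close>; the prefix \<open>ws\<close> collects the factors already expanded.\<close>

lemma affine_line_morphism_linear_family_aux:
  assumes "length ws + length vs = d"
  shows "affine_line_morphism scale UNIV d
           (\<lambda>t. sym_class scale UNIV d (Poly_Mapping.single (ws @ map (\<lambda>v. P v + scale t (Q v)) vs) 1))"
  using assms
proof (induction vs arbitrary: ws)
  case Nil
  thus ?case
    by (auto intro!: affine_line_morphism_const simp: formal_tensors_def free_on_def tuples_def)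
next
  case (Cons v vs)
  let ?e = "\<lambda>w ys. Poly_Mapping.single (ws @ w # ys) 1"
  let ?N = "sym_null scale UNIV d"
  have "sym_class scale UNIV d (?e (P v + scale t (Q v)) ys)
          = sym_class scale UNIV d (?e (P v) ys + fscale t (?e (Q v) ys))"
    if "length ws + Suc (length ys) = d" for t ys
  proof -
    have "?e (P v + scale t (Q v)) ys - ?e (P v) ys - ?e (scale t (Q v)) ys \<in> ?N"
      using that by (intro tensor_add_in_sym_null) simp
    moreover have "?e (scale t (Q v)) ys - fscale t (?e (Q v) ys) \<in> ?N"
      using that tensor_scale_in_sym_null[of ws ys d scale t "Q v"] by (simp add: fscale_single)
    ultimately have "(?e (P v + scale t (Q v)) ys - ?e (P v) ys - ?e (scale t (Q v)) ys)
        + (?e (scale t (Q v)) ys - fscale t (?e (Q v) ys)) \<in> ?N"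
      using fs.subspace_add[OF subspace_sym_null] by blast
    thus ?thesis
      unfolding sym_class_eq_iff by (simp add: algebra_simps)
  qed
  hence "(\<lambda>t. sym_class scale UNIV d (?e (P v + scale t (Q v)) (map (\<lambda>v. P v + scale t (Q v)) vs)))
    = (\<lambda>t. sym_class scale UNIV d (?e (P v) (map (\<lambda>v. P v + scale t (Q v)) vs)
         + fscale t (?e (Q v) (map (\<lambda>v. P v + scale t (Q v)) vs))))"
    using Cons.prems by auto
  moreover have "affine_line_morphism scale UNIV d
      (\<lambda>t. sym_class scale UNIV d (?e w (map (\<lambda>v. P v + scale t (Q v)) vs)))" for w
    using Cons.IH[of "ws @ [w]"] Cons.prems by simp
  ultimately show ?case
    by (simp add: affine_line_morphism_add affine_line_morphism_fscale_parameter)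
qed

lemma affine_line_morphism_linear_family:
  assumes "T \<in> formal_tensors UNIV d"
  shows "affine_line_morphism scale UNIV d
           (\<lambda>t. sym_class scale UNIV d (free_map (map (\<lambda>v. P v + scale t (Q v))) T))"
proof -
  have "affine_line_morphism scale UNIV d (\<lambda>t. sym_class scale UNIV d
     (fscale (Poly_Mapping.lookup T xs) (Poly_Mapping.single (map (\<lambda>v. P v + scale t (Q v)) xs) 1)))"
    if "xs \<in> Poly_Mapping.keys T" for xs
    using affine_line_morphism_linear_family_aux[of "[]" xs d scale P Q] that assms
    by (intro affine_line_morphism_fscale) (auto simp: formal_tensors_def free_on_def tuples_def)
  thus ?thesis
    using affine_line_morphism_sum[of "Poly_Mapping.keys T" scale UNIV d
      "\<lambda>xs t. fscale (Poly_Mapping.lookup T xs) (Poly_Mapping.single (map (\<lambda>v. P v + scale t (Q v)) xs) 1)"]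
    by (simp add: free_map_def fscale_single)
qed

section \<open>Subgroups fixing a sum of powers of independent vectors\<close>

lemma dual_functional:
  fixes scale :: "'k::field \<Rightarrow> 'v::ab_group_add \<Rightarrow> 'v"
  assumes vs: "vector_space scale" and inj: "inj_on u J"
    and ind: "\<not> module.dependent scale (u ` J)" and j: "j \<in> J"
  obtains \<beta> where "Vector_Spaces.linear scale (*) \<beta>" "\<And>i. i \<in> J \<Longrightarrow> \<beta> (u i) = (if i = j then 1 else 0)"
proof -
  interpret V: vector_space scale by (rule vs)
  interpret K: vector_space "(*) :: 'k \<Rightarrow> 'k \<Rightarrow> 'k" by (rule vector_space_field)
  interpret P: vector_space_pair scale "(*) :: 'k \<Rightarrow> 'k \<Rightarrow> 'k" ..
  obtain \<beta> where \<beta>: "Vector_Spaces.linear scale (*) \<beta>"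
      "\<forall>x\<in>u ` J. \<beta> x = (if x = u j then 1 else 0)"
    using P.linear_independent_extend[OF ind, of "\<lambda>x. if x = u j then 1 else 0"] by blast
  show thesis
    using \<beta> inj j by (intro that[OF \<beta>(1)]) (auto dest: inj_onD)
qed

text \<open>The coefficients \<open>A i\<close> of the Laurent polynomial \<open>\<gamma>\<close> are the projections onto its weight
  spaces. The properties recorded here come from comparing coefficients of \<open>t\<close> in
  \<open>\<gamma>(t) \<gamma>(s) = \<gamma>(t s)\<close> and from \<open>\<gamma>(1) = id\<close>. The index \<open>0\<close> is always included in \<open>I\<close>, with
  \<open>A 0 = 0\<close> if the weight does not occur, since the projection onto the fixed vectors is the one
  that the comparison of the subranks is about.\<close>

lemma one_param_weights:
  fixes scale :: "'k::alg_closed_field \<Rightarrow> 'v::ab_group_add \<Rightarrow> 'v"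
  assumes vs: "vector_space scale" and \<gamma>: "one_param_subgroup scale \<gamma>"
  obtains I :: "int set" and A where "finite I" "0 \<in> I" "\<And>i. Vector_Spaces.linear scale scale (A i)"
    "\<And>v. (\<Sum>i\<in>I. A i v) = v"
    "\<And>i s v. i \<in> I \<Longrightarrow> s \<noteq> 0 \<Longrightarrow> A i (\<gamma> s v) = scale (s powi i) (A i v)"
proof -
  interpret V: vector_space scale by (rule vs)
  interpret VV: vector_space_pair scale scale ..
  have gl: "\<And>t. t \<noteq> 0 \<Longrightarrow> \<gamma> t \<in> general_linear scale"
    and hom: "\<And>s t. s \<noteq> 0 \<Longrightarrow> t \<noteq> 0 \<Longrightarrow> \<gamma> (s * t) = \<gamma> s \<circ> \<gamma> t"
    using \<gamma> unfolding one_param_subgroup_def by blast+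
  obtain I0 :: "int set" and A0 where I0: "finite I0" "\<forall>i\<in>I0. Vector_Spaces.linear scale scale (A0 i)"
      "\<forall>t v. t \<noteq> 0 \<longrightarrow> \<gamma> t v = (\<Sum>i\<in>I0. scale (t powi i) (A0 i v))"
    using \<gamma> unfolding one_param_subgroup_def by blast
  define I where "I = insert 0 I0"
  define A where "A i = (if i \<in> I0 then A0 i else (\<lambda>_. 0))" for i
  have fin: "finite I" using I0(1) by (simp add: I_def)
  have lin: "Vector_Spaces.linear scale scale (A i)" for i
    using I0(2) VV.linear_zero by (simp add: A_def)
  have exp: "\<gamma> t v = (\<Sum>i\<in>I. scale (t powi i) (A i v))" if "t \<noteq> 0" for t v
  proof -
    have "(\<Sum>i\<in>I. scale (t powi i) (A i v)) = (\<Sum>i\<in>I0. scale (t powi i) (A0 i v))"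
      using fin by (intro sum.mono_neutral_cong_right) (auto simp: I_def A_def)
    thus ?thesis using I0(3) that by simp
  qed
  have weight: "A i (\<gamma> s v) = scale (s powi i) (A i v)" if "i \<in> I" "s \<noteq> 0" for i s v
  proof -
    have "(\<Sum>i\<in>I. scale (t powi i) (A i (\<gamma> s v) - scale (s powi i) (A i v))) \<in> {0}" if "t \<noteq> 0" for t
      using hom[of t s] exp[of t "\<gamma> s v"] exp[of "t * s" v] that \<open>s \<noteq> 0\<close>
      by (simp add: V.scale_right_diff_distrib sum_subtractf power_int_mult_distrib)
    from laurent_vanishing_mod_subspace[OF vs V.subspace_single_0 fin this \<open>i \<in> I\<close>]
    show ?thesis by simp
  qed
  have "\<gamma> 1 v = v" for v
  proof -
    \<comment> \<open>an injective idempotent map is the identity\<close>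
    have "inj (\<gamma> 1)" using gl[of 1] by (simp add: general_linear_def bij_is_inj)
    moreover have "\<gamma> 1 (\<gamma> 1 v) = \<gamma> 1 v" using hom[of 1 1] by (metis comp_apply mult_1 zero_neq_one)
    ultimately show ?thesis by (simp add: inj_eq)
  qed
  hence "(\<Sum>i\<in>I. A i v) = v" for v
    using exp[of 1 v] by simp
  thus thesis
    using that[OF fin _ lin _ weight] by (simp add: I_def)
qed

text \<open>A torus that fixes \<open>\<Sum>\<^sub>j u\<^sub>j\<^sup>d\<close> with independent \<open>u\<^sub>j\<close> fixes every \<open>u\<^sub>j\<close>. The full stabilizer
  need not permute the lines spanned by the \<open>u\<^sub>j\<close> (in characteristic \<open>p\<close>, for \<open>d = p\<^sup>k + 1\<close> with
  \<open>k \<ge> 1\<close>, it contains a finite unitary group), so the argument uses the weights instead: a weight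
  \<open>b\<close> forces the weight \<open>-(m-1) b\<close>. For \<open>m = 2\<close> the conclusion is false: a torus of rotations
  fixes \<open>x\<^sup>2 + y\<^sup>2\<close>.\<close>

lemma fixes_power_sum_imp_weight_zero:
  fixes scale :: "'k::alg_closed_field \<Rightarrow> 'v::ab_group_add \<Rightarrow> 'v" and I :: "int set"
  assumes vs: "vector_space scale"
    and d: "d = characteristic_exponent TYPE('k) ^ k * m" "of_nat m \<noteq> (0::'k)" "m \<ge> 3"
    and I: "finite I" "0 \<in> I" and A: "\<And>i. Vector_Spaces.linear scale scale (A i)"
    and id: "\<And>v. (\<Sum>i\<in>I. A i v) = v"
    and weight: "\<And>i s v. i \<in> I \<Longrightarrow> s \<noteq> 0 \<Longrightarrow> A i (\<gamma> s v) = scale (s powi i) (A i v)"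
    and fin: "finite J" and inj: "inj_on u J" and ind: "\<not> module.dependent scale (u ` J)"
    and fixed: "\<And>s \<alpha>. s \<noteq> 0 \<Longrightarrow> Vector_Spaces.linear scale (*) \<alpha>
        \<Longrightarrow> (\<Sum>j\<in>J. \<alpha> (\<gamma> s (u j)) ^ d) = (\<Sum>j\<in>J. \<alpha> (u j) ^ d)"
    and j: "j \<in> J"
  shows "A 0 (u j) = u j"
proof -
  interpret V: vector_space scale by (rule vs)
  interpret K: vector_space "(*) :: 'k \<Rightarrow> 'k \<Rightarrow> 'k" by (rule vector_space_field)
  interpret P: vector_space_pair scale "(*) :: 'k \<Rightarrow> 'k \<Rightarrow> 'k" ..
  let ?F = "\<lambda>\<beta> \<alpha> u. \<Sum>j\<in>J. (\<beta> (u j) :: 'k) * \<alpha> (u j) ^ (m - 1)"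
  have F: "?F \<beta> \<alpha> (\<lambda>j. \<gamma> s (u j)) = ?F \<beta> \<alpha> u"
    if "s \<noteq> 0" and lin: "Vector_Spaces.linear scale (*) \<alpha>" "Vector_Spaces.linear scale (*) \<beta>" for s \<alpha> \<beta>
  proof (rule power_sum_derivative[OF d(1,2)])
    fix x
    have "Vector_Spaces.linear scale (*) (\<lambda>v. \<alpha> v + x * \<beta> v)"
      using P.linear_compose_add[OF lin(1) P.linear_compose_scale_right[OF lin(2)]] .
    thus "(\<Sum>j\<in>J. (\<alpha> (\<gamma> s (u j)) + x * \<beta> (\<gamma> s (u j))) ^ d) = (\<Sum>j\<in>J. (\<alpha> (u j) + x * \<beta> (u j)) ^ d)"
      using fixed[OF that(1)] by blast
  qed
  define B where "B = {b \<in> I. \<exists>j\<in>J. A b (u j) \<noteq> 0}"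
  have next_weight: "- int (m - 1) * b \<in> B" if b: "b \<in> B" for b
  proof -
    obtain j where j: "b \<in> I" "j \<in> J" "A b (u j) \<noteq> 0" using b by (auto simp: B_def)
    obtain \<alpha>0 where \<alpha>0: "Vector_Spaces.linear scale (*) \<alpha>0" "\<alpha>0 (A b (u j)) = 1"
      using separating_functional[OF vs V.subspace_single_0, of "A b (u j)"] j(3) by blast
    \<comment> \<open>a functional of weight \<open>b\<close> with \<open>\<alpha> (u j) = 1\<close>\<close>
    define \<alpha> where "\<alpha> = \<alpha>0 \<circ> A b"
    have \<alpha>: "Vector_Spaces.linear scale (*) \<alpha>"
      unfolding \<alpha>_def by (rule Vector_Spaces.linear_compose[OF A \<alpha>0(1)])
    obtain \<beta> where \<beta>: "Vector_Spaces.linear scale (*) \<beta>" "\<And>i. i \<in> J \<Longrightarrow> \<beta> (u i) = (if i = j then 1 else 0)"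
      using dual_functional[OF vs inj ind j(2)] by blast
    interpret \<beta>: Vector_Spaces.linear scale "(*)" \<beta> by (rule \<beta>(1))
    interpret \<alpha>0: Vector_Spaces.linear scale "(*)" \<alpha>0 by (rule \<alpha>0(1))
    \<comment> \<open>\<open>F(\<beta>, \<alpha>) = 1\<close>, so the part of \<open>\<beta>\<close> of some weight \<open>a\<close> pairs nontrivially with \<open>\<alpha>\<close>\<close>
    have "(\<Sum>a\<in>I. ?F (\<beta> \<circ> A a) \<alpha> u) = ?F \<beta> \<alpha> u"
    proof -
      have "(\<Sum>a\<in>I. ?F (\<beta> \<circ> A a) \<alpha> u) = (\<Sum>i\<in>J. (\<Sum>a\<in>I. \<beta> (A a (u i))) * \<alpha> (u i) ^ (m - 1))"
        by (subst sum.swap) (simp only: sum_distrib_right comp_apply)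
      thus ?thesis
        by (simp only: \<beta>.sum[symmetric] id)
    qed
    also have "\<dots> = (\<Sum>i\<in>J. if i = j then \<alpha> (u i) ^ (m - 1) else 0)"
      by (intro sum.cong) (auto simp: \<beta>(2))
    also have "\<dots> = 1"
      using fin j(2) \<alpha>0(2) by (simp add: \<alpha>_def)
    finally have "(\<Sum>a\<in>I. ?F (\<beta> \<circ> A a) \<alpha> u) \<noteq> 0" by simp
    then obtain a where a: "a \<in> I" "?F (\<beta> \<circ> A a) \<alpha> u \<noteq> 0"
      by (rule sum.not_neutral_contains_not_neutral)
    have "a \<in> B"
    proof (rule ccontr)
      assume "a \<notin> B"
      hence "?F (\<beta> \<circ> A a) \<alpha> u = 0"
        using a(1) by (intro sum.neutral) (auto simp: B_def \<beta>.zero)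
      thus False using a(2) by simp
    qed
    moreover have "a + int (m - 1) * b = 0"
    proof (rule ccontr)
      assume nz: "a + int (m - 1) * b \<noteq> 0"
      \<comment> \<open>\<open>F(\<beta> \<circ> A\<^sub>a, \<alpha>)\<close> is invariant under \<open>\<gamma> s\<close> and is also scaled by this power of \<open>s\<close>\<close>
      have "s powi (a + int (m - 1) * b) = 1" if s: "s \<noteq> 0" for s :: 'k
      proof -
        have "?F (\<beta> \<circ> A a) \<alpha> (\<lambda>j. \<gamma> s (u j)) = s powi (a + int (m - 1) * b) * ?F (\<beta> \<circ> A a) \<alpha> u"
          unfolding sum_distrib_left
        proof (rule sum.cong)
          fix i assume "i \<in> J"
          have "\<alpha> (\<gamma> s (u i)) ^ (m - 1) = s powi (int (m - 1) * b) * \<alpha> (u i) ^ (m - 1)"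
            using s j(1)
            by (simp add: \<alpha>_def weight \<alpha>0.scale power_mult_distrib power_int_power' mult.commute[of b])
          moreover have "(\<beta> \<circ> A a) (\<gamma> s (u i)) = s powi a * (\<beta> \<circ> A a) (u i)"
            using s a(1) by (simp add: weight \<beta>.scale)
          moreover have "s powi (a + int (m - 1) * b) = s powi a * s powi (int (m - 1) * b)"
            using s by (rule power_int_add[OF disjI1])
          ultimately show "(\<beta> \<circ> A a) (\<gamma> s (u i)) * \<alpha> (\<gamma> s (u i)) ^ (m - 1)
              = s powi (a + int (m - 1) * b) * ((\<beta> \<circ> A a) (u i) * \<alpha> (u i) ^ (m - 1))"
            by (simp only: mult_ac)
        qed simp
        also have "?F (\<beta> \<circ> A a) \<alpha> (\<lambda>j. \<gamma> s (u j)) = ?F (\<beta> \<circ> A a) \<alpha> u"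
          by (rule F[OF s \<alpha> Vector_Spaces.linear_compose[OF A \<beta>(1)]])
        finally show ?thesis using a(2) by simp
      qed
      thus False
        using scalar_laurent_vanishing[of "{0, a + int (m - 1) * b}" "\<lambda>i. if i = 0 then -1 else 1 :: 'k"
            "a + int (m - 1) * b"] nz by simp
    qed
    ultimately show ?thesis by (simp add: eq_neg_iff_add_eq_0[symmetric])
  qed
  have "B \<subseteq> {0}"
  proof (rule ccontr)
    assume "\<not> B \<subseteq> {0}"
    then obtain b0 where b0: "b0 \<in> B" "b0 \<noteq> 0" by blast
    have finB: "finite B" using I(1) by (simp add: B_def)
    \<comment> \<open>a weight of largest absolute value contradicts \<open>next_weight\<close>\<close>
    have "Max (abs ` B) \<in> abs ` B"
      using finB b0(1) by (intro Max_in) auto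
    then obtain b where b: "b \<in> B" "\<bar>b\<bar> = Max (abs ` B)" by auto
    have b_max: "\<bar>b'\<bar> \<le> \<bar>b\<bar>" if "b' \<in> B" for b'
      unfolding b(2) using finB that by (intro Max_ge) auto
    have "b \<noteq> 0" using b_max[OF b0(1)] b0(2) by auto
    hence "2 * \<bar>b\<bar> \<le> int (m - 1) * \<bar>b\<bar>" "0 < \<bar>b\<bar>" using d(3) by auto
    moreover have "int (m - 1) * \<bar>b\<bar> \<le> \<bar>b\<bar>"
      using b_max[OF next_weight[OF b(1)]] by (simp add: abs_mult)
    ultimately show False by linarith
  qed
  hence "(\<Sum>i\<in>I. A i (u j)) = (\<Sum>i\<in>{0}. A i (u j))"
    using I j by (intro sum.mono_neutral_right) (auto simp: B_def)
  thus ?thesis using id by simp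
qed


section \<open>Comparing the two subranks\<close>

lemma free_map_power_sum:
  "free_map (map \<phi>) (\<Sum>j\<in>J. Poly_Mapping.single (replicate d (u j)) 1)
     = (\<Sum>j\<in>J. Poly_Mapping.single (replicate d (\<phi> (u j))) 1)"
  by (simp add: free_map_sum)

lemma linear_lookup: "Vector_Spaces.linear fscale (*) (\<lambda>F. Poly_Mapping.lookup F j)"
proof -
  interpret K: vector_space "(*) :: 'k::field \<Rightarrow> 'k \<Rightarrow> 'k" by (rule vector_space_field)
  show ?thesis by unfold_locales (simp_all add: lookup_add)
qed

text \<open>For a functional \<open>l\<close> that vanishes on the range of \<open>\<phi>\<close>, the value of \<open>\<phi> T\<close> does not change
  along the direction \<open>l\<close>. By \<open>power_sum_derivative\<close> at the \<open>j\<close>-th coordinate functional this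
  gives \<open>l(e\<^sub>j) = 0\<close>. For \<open>m = 1\<close> and \<open>r \<ge> 2\<close> the conclusion can fail, as \<open>I\<^sub>r\<close> is then the single
  power \<open>(e\<^sub>1 + \<dots> + e\<^sub>r)\<^sup>d\<close>.\<close>

lemma unit_tensor_image_imp_onto:
  fixes scale :: "'k::alg_closed_field \<Rightarrow> 'v::ab_group_add \<Rightarrow> 'v"
  assumes d: "d = characteristic_exponent TYPE('k) ^ k * m" "of_nat m \<noteq> (0::'k)" "m \<ge> 2"
    and \<phi>: "Vector_Spaces.linear scale fscale \<phi>"
    and unit: "sym_class fscale (coord_space r) d (free_map (map \<phi>) T) = unit_tensor d r"
    and j: "j < r"
  shows "coord_vec j \<in> range \<phi>"
proof (rule ccontr)
  assume notin: "coord_vec j \<notin> range \<phi>"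
  interpret \<phi>: Vector_Spaces.linear scale fscale \<phi> by (rule \<phi>)
  interpret K: vector_space "(*) :: 'k \<Rightarrow> 'k \<Rightarrow> 'k" by (rule vector_space_field)
  interpret P: vector_space_pair "fscale :: 'k \<Rightarrow> (nat \<Rightarrow>\<^sub>0 'k) \<Rightarrow> _" "(*) :: 'k \<Rightarrow> 'k \<Rightarrow> 'k" ..
  have "fs.subspace (range \<phi>)"
    by (rule \<phi>.subspace_image) (rule \<phi>.vs1.subspace_UNIV)
  from separating_functional[OF vector_space_fscale this notin]
  obtain l where l: "Vector_Spaces.linear fscale (*) l" "\<And>x. x \<in> range \<phi> \<Longrightarrow> l x = 0" "l (coord_vec j) = 1"
    by metis
  let ?\<alpha> = "\<lambda>F. Poly_Mapping.lookup F j :: 'k"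
  have "(\<Sum>i<r. l (coord_vec i) * ?\<alpha> (coord_vec i) ^ (m - 1)) = (\<Sum>i<r. 0 * ?\<alpha> (coord_vec i) ^ (m - 1))"
  proof (rule power_sum_derivative[OF d(1,2)])
    fix x
    have null: "free_map (map \<phi>) T - (\<Sum>i<r. Poly_Mapping.single (replicate d (coord_vec i)) 1)
        \<in> sym_null fscale (coord_space r) d"
      using unit unfolding unit_tensor_def power_sum_def sym_class_eq_iff .
    have eval: "(\<Sum>i<r. \<beta> (coord_vec i) ^ d) = tensor_eval (\<beta> \<circ> \<phi>) T"
      if "Vector_Spaces.linear fscale (*) \<beta>" for \<beta>
      using tensor_eval_cong_sym_null[OF that null]
      by (simp only: tensor_eval_power_sum tensor_eval_free_map)
    have "Vector_Spaces.linear fscale (*) (\<lambda>v. ?\<alpha> v + x * l v)"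
      using P.linear_compose_add[OF linear_lookup P.linear_compose_scale_right[OF l(1)]] .
    note eval[OF this]
    also have "(\<lambda>v. ?\<alpha> v + x * l v) \<circ> \<phi> = ?\<alpha> \<circ> \<phi>"
      by (auto simp: l(2))
    also have "tensor_eval (?\<alpha> \<circ> \<phi>) T = (\<Sum>i<r. ?\<alpha> (coord_vec i) ^ d)"
      by (rule eval[OF linear_lookup, symmetric])
    finally show "(\<Sum>i<r. (?\<alpha> (coord_vec i) + x * l (coord_vec i)) ^ d)
        = (\<Sum>i<r. (?\<alpha> (coord_vec i) + x * 0) ^ d)"
      by simp
  qed
  moreover have "(\<Sum>i<r. l (coord_vec i) * ?\<alpha> (coord_vec i) ^ (m - 1)) = (\<Sum>i<r. if i = j then 1 else 0)"
    using l(3) d(3) by (intro sum.cong) (auto simp: coord_vec_def lookup_single when_def)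
  ultimately show False using j by simp
qed

lemma coord_space_eq_span: "(coord_space r :: (nat \<Rightarrow>\<^sub>0 'k::field) set) = fs.span (coord_vec ` {..<r})"
proof
  show "fs.span (coord_vec ` {..<r}) \<subseteq> (coord_space r :: (nat \<Rightarrow>\<^sub>0 'k) set)"
  proof (rule fs.span_minimal)
    show "fs.subspace (coord_space r :: (nat \<Rightarrow>\<^sub>0 'k) set)"
      unfolding coord_space_def using subspace_free_on by blast
  qed (auto simp: coord_vec_def coord_space_def free_on_def)
next
  show "(coord_space r :: (nat \<Rightarrow>\<^sub>0 'k) set) \<subseteq> fs.span (coord_vec ` {..<r})"
  proof
    fix F :: "nat \<Rightarrow>\<^sub>0 'k" assume "F \<in> coord_space r"
    hence keys: "Poly_Mapping.keys F \<subseteq> {..<r}" by (simp add: coord_space_def free_on_def)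
    have "F = (\<Sum>i\<in>Poly_Mapping.keys F. Poly_Mapping.single i (Poly_Mapping.lookup F i))"
      by (rule poly_mapping_eqI) (auto simp: lookup_sum lookup_single when_def in_keys_iff)
    also have "\<dots> = (\<Sum>i\<in>Poly_Mapping.keys F. fscale (Poly_Mapping.lookup F i) (coord_vec i))"
      by (simp add: coord_vec_def fscale_single)
    also have "\<dots> \<in> fs.span (coord_vec ` {..<r})"
      using keys by (intro fs.span_sum fs.span_scale fs.span_base) auto
    finally show "F \<in> fs.span (coord_vec ` {..<r})" .
  qed
qed

lemma inj_coord_vec: "inj_on (coord_vec :: nat \<Rightarrow> nat \<Rightarrow>\<^sub>0 'k::field) J"
proof (rule inj_onI)
  fix i j assume "(coord_vec i :: nat \<Rightarrow>\<^sub>0 'k) = coord_vec j"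
  hence "Poly_Mapping.lookup (coord_vec i :: nat \<Rightarrow>\<^sub>0 'k) i = Poly_Mapping.lookup (coord_vec j) i" by simp
  thus "i = j" by (simp add: coord_vec_def lookup_single when_def split: if_splits)
qed

lemma independent_coord_vec: "fs.independent (coord_vec ` J :: (nat \<Rightarrow>\<^sub>0 'k::field) set)"
proof -
  show "fs.independent (coord_vec ` J :: (nat \<Rightarrow>\<^sub>0 'k) set)"
    unfolding fs.dependent_explicit
  proof safe
    fix S and c :: "(nat \<Rightarrow>\<^sub>0 'k) \<Rightarrow> 'k" and v
    assume S: "finite S" "S \<subseteq> coord_vec ` J" "(\<Sum>v\<in>S. fscale (c v) v) = 0"
      and v: "v \<in> S" "c v \<noteq> 0"
    obtain j where j: "coord_vec j \<in> S" "c (coord_vec j) \<noteq> 0"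
      using S(2) v by blast
    have "0 = Poly_Mapping.lookup (\<Sum>v\<in>S. fscale (c v) v) j" using S(3) by simp
    also have "\<dots> = (\<Sum>v\<in>S. if v = coord_vec j then c v else 0)"
      unfolding lookup_sum
    proof (rule sum.cong)
      fix v assume "v \<in> S"
      then obtain i where "v = coord_vec i" using S(2) by blast
      thus "Poly_Mapping.lookup (fscale (c v) v) j = (if v = coord_vec j then c v else 0)"
        using inj_onD[OF inj_coord_vec, of i j UNIV]
        by (cases "i = j") (auto simp: coord_vec_def lookup_single)
    qed simp
    also have "\<dots> = c (coord_vec j)" using S(1) j(1) by simp
    finally show False using j(2) by simp
  qed
qed

lemma subrank_imp_HM:
  fixes scale :: "'k::alg_closed_field \<Rightarrow> 'v::ab_group_add \<Rightarrow> 'v"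
  assumes vs: "vector_space scale"
    and d: "d = characteristic_exponent TYPE('k) ^ k * m" "of_nat m \<noteq> (0::'k)" "m \<ge> 3"
    and f: "f \<in> sym_power scale UNIV d"
    and \<phi>: "Vector_Spaces.linear scale fscale \<phi>" "range \<phi> \<subseteq> coord_space r"
    and unit: "sym_map fscale (coord_space r) d \<phi> f = unit_tensor d r"
  shows "\<exists>\<gamma>. one_param_subgroup scale \<gamma> \<and>
            (\<exists>L\<in>unit_orbit scale d r. has_limit_at_0 scale UNIV d (\<lambda>t. sym_map scale UNIV d (\<gamma> t) f) L)"
proof -
  interpret V: vector_space scale by (rule vs)
  interpret P: vector_space_pair "fscale :: 'k \<Rightarrow> (nat \<Rightarrow>\<^sub>0 'k) \<Rightarrow> _" scale ..
  interpret \<phi>: Vector_Spaces.linear scale fscale \<phi> by (rule \<phi>(1))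
  obtain T where T: "T \<in> formal_tensors UNIV d" "f = sym_class scale UNIV d T"
    using f unfolding sym_power_def by blast
  have unit_T: "sym_class fscale (coord_space r) d (free_map (map \<phi>) T) = unit_tensor d r"
    using unit unfolding T(2) by (subst (asm) sym_map_class[OF \<phi>(1)]) (use \<phi>(2) in auto)
  have "\<forall>j<r. \<exists>v. \<phi> v = coord_vec j"
    using unit_tensor_image_imp_onto[OF d(1,2) _ \<phi>(1) unit_T] d(3) by (fastforce elim: rangeE)
  then obtain u where u: "\<And>j. j < r \<Longrightarrow> \<phi> (u j) = coord_vec j" by metis
  obtain s where s: "Vector_Spaces.linear fscale scale s" "\<forall>x\<in>coord_vec ` {..<r}. s x = u (the_inv_into {..<r} coord_vec x)"
    using P.linear_independent_extend[OF independent_coord_vec,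
        of "{..<r}" "\<lambda>x. u (the_inv_into {..<r} coord_vec x)"] by blast
  interpret s: Vector_Spaces.linear fscale scale s by (rule s(1))
  have s_coord: "s (coord_vec j) = u j" if "j < r" for j
    using s(2) that by (simp add: the_inv_into_f_f[OF inj_coord_vec])
  have sec: "\<phi> (s x) = x" if "x \<in> coord_space r" for x
  proof -
    have "Vector_Spaces.linear fscale fscale (\<lambda>x. \<phi> (s x) - x)"
      by unfold_locales (simp_all add: s.add \<phi>.add s.scale \<phi>.scale fs.scale_right_diff_distrib)
    then interpret D: Vector_Spaces.linear fscale fscale "\<lambda>x. \<phi> (s x) - x" .
    have "\<phi> (s x) - x = 0" if "x \<in> coord_vec ` {..<r}" for x
      using that by (auto simp: s_coord u)
    from D.eq_0_on_span[OF this] show ?thesis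
      using that by (simp add: coord_space_eq_span)
  qed
  define \<pi> where "\<pi> = s \<circ> \<phi>"
  interpret \<pi>: Vector_Spaces.linear scale scale \<pi>
    unfolding \<pi>_def by (rule Vector_Spaces.linear_compose[OF \<phi>(1) s(1)])
  have idem: "\<pi> (\<pi> v) = \<pi> v" for v
    using sec[OF subsetD[OF \<phi>(2) rangeI]] by (simp add: \<pi>_def)
  \<comment> \<open>weight \<open>0\<close> on the range of \<open>\<pi>\<close>, weight \<open>1\<close> on its kernel\<close>
  define \<gamma> where "\<gamma> t v = \<pi> v + scale t (v - \<pi> v)" for t v
  have lin: "Vector_Spaces.linear scale scale (\<gamma> t)" for t
    unfolding \<gamma>_def
    by unfold_locales (simp_all add: \<pi>.add \<pi>.scale V.scale_right_distrib V.scale_right_diff_distrib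
        V.scale_left_commute algebra_simps)
  have lin': "Vector_Spaces.linear scale scale (\<lambda>v. v - \<pi> v)"
    by unfold_locales (simp_all add: \<pi>.add \<pi>.scale V.scale_right_diff_distrib)
  have hom: "\<gamma> (a * b) = \<gamma> a \<circ> \<gamma> b" for a b
    by (auto simp: \<gamma>_def \<pi>.add \<pi>.scale \<pi>.diff idem)
  have one: "\<gamma> 1 = id"
    by (auto simp: \<gamma>_def)
  have "one_param_subgroup scale \<gamma>"
    unfolding one_param_subgroup_def general_linear_def
  proof (intro conjI allI impI CollectI lin)
    fix t :: 'k assume "t \<noteq> 0"
    thus "bij (\<gamma> t)"
      using hom[of t "inverse t"] hom[of "inverse t" t] one by (intro o_bij[of "\<gamma> (inverse t)"]) auto
  next
    show "\<exists>(I::int set) A. finite I \<and> (\<forall>i\<in>I. Vector_Spaces.linear scale scale (A i)) \<and>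
        (\<forall>t v. t \<noteq> 0 \<longrightarrow> \<gamma> t v = (\<Sum>i\<in>I. scale (t powi i) (A i v)))"
      using lin' \<pi>.linear_axioms
      by (intro exI[of _ "{0, 1}"] exI[of _ "\<lambda>i. if i = 0 then \<pi> else (\<lambda>v. v - \<pi> v)"])
         (simp add: \<gamma>_def)
  qed (rule hom)
  moreover have "has_limit_at_0 scale UNIV d (\<lambda>t. sym_map scale UNIV d (\<gamma> t) f) (power_sum scale UNIV d r u)"
    unfolding has_limit_at_0_def
  proof (intro exI conjI allI impI)
    show "affine_line_morphism scale UNIV d (\<lambda>t. sym_class scale UNIV d (free_map (map (\<gamma> t)) T))"
      unfolding \<gamma>_def by (rule affine_line_morphism_linear_family[OF T(1)])
    show "sym_class scale UNIV d (free_map (map (\<gamma> t)) T) = sym_map scale UNIV d (\<gamma> t) f" for t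
      unfolding T(2) by (subst sym_map_class[OF lin]) simp_all
    have "\<gamma> 0 = s \<circ> \<phi>"
      by (simp add: fun_eq_iff \<gamma>_def \<pi>_def)
    hence "sym_class scale UNIV d (free_map (map (\<gamma> 0)) T) = sym_class scale UNIV d (free_map (map s) (free_map (map \<phi>) T))"
      by (simp add: free_map_free_map map_comp_map)
    also have "\<dots> = sym_map scale UNIV d s (unit_tensor d r)"
      unfolding unit_T[symmetric] by (subst sym_map_class[OF s(1)]) simp_all
    also have "\<dots> = power_sum scale UNIV d r u"
      unfolding unit_tensor_def power_sum_def
      by (subst sym_map_class[OF s(1)]) (simp_all add: free_map_power_sum s_coord)
    finally show "sym_class scale UNIV d (free_map (map (\<gamma> 0)) T) = power_sum scale UNIV d r u" .
  qed
  moreover have "power_sum scale UNIV d r u \<in> unit_orbit scale d r"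
    unfolding unit_orbit_def
  proof (intro CollectI exI conjI)
    show "id \<in> general_linear scale"
      using V.linear_id by (simp add: general_linear_def)
    show "power_sum scale UNIV d r u = sym_map scale UNIV d id (power_sum scale UNIV d r u)"
      unfolding power_sum_def
      by (subst sym_map_class[OF V.linear_id]) (simp_all add: free_map_sum)
    show "inj_on u {..<r}"
      using u inj_coord_vec[of "{..<r}"] by (metis inj_on_def lessThan_iff)
    have "inj_on s (fs.span (coord_vec ` {..<r}))"
      unfolding coord_space_eq_span[symmetric] by (rule inj_on_inverseI) (rule sec)
    hence "V.independent (s ` coord_vec ` {..<r})"
      by (intro s.independent_injective_image independent_coord_vec)
    moreover have "s ` coord_vec ` {..<r} = u ` {..<r}"
      using s_coord by (force simp: image_image)
    ultimately show "\<not> V.dependent (u ` {..<r})" by simp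
  qed
  ultimately show ?thesis by blast
qed

lemma HM_imp_subrank:
  fixes scale :: "'k::alg_closed_field \<Rightarrow> 'v::ab_group_add \<Rightarrow> 'v"
  assumes vs: "vector_space scale"
    and d: "d = characteristic_exponent TYPE('k) ^ k * m" "of_nat m \<noteq> (0::'k)" "m \<ge> 3"
    and f: "f \<in> sym_power scale UNIV d"
    and \<gamma>: "one_param_subgroup scale \<gamma>"
    and L: "L \<in> unit_orbit scale d r"
    and lim: "has_limit_at_0 scale UNIV d (\<lambda>t. sym_map scale UNIV d (\<gamma> t) f) L"
  shows "\<exists>\<phi>. Vector_Spaces.linear scale fscale \<phi> \<and> range \<phi> \<subseteq> coord_space r
                 \<and> sym_map fscale (coord_space r) d \<phi> f = unit_tensor d r"
proof -
  interpret V: vector_space scale by (rule vs)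
  interpret P: vector_space_pair scale "fscale :: 'k \<Rightarrow> (nat \<Rightarrow>\<^sub>0 'k) \<Rightarrow> _" ..
  let ?N = "sym_null scale UNIV d"
  note sub = subspace_sym_null[of scale UNIV d]
  note sub_add = fs.subspace_add[OF sub] and sub_diff = fs.subspace_diff[OF sub]
  have lin: "Vector_Spaces.linear scale scale (\<gamma> t)" if "t \<noteq> 0" for t
    using \<gamma> that unfolding one_param_subgroup_def general_linear_def by blast
  have hom: "\<gamma> (a * b) = \<gamma> a \<circ> \<gamma> b" if "a \<noteq> 0" "b \<noteq> 0" for a b
    using \<gamma> that unfolding one_param_subgroup_def by blast
  obtain T where T: "T \<in> formal_tensors UNIV d" "f = sym_class scale UNIV d T"
    using f unfolding sym_power_def by blast
  obtain g u where gu: "g \<in> general_linear scale" "inj_on u {..<r}" "V.independent (u ` {..<r})"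
      "L = sym_map scale UNIV d g (power_sum scale UNIV d r u)"
    using L unfolding unit_orbit_def by blast
  have g: "Vector_Spaces.linear scale scale g" "bij g"
    using gu(1) by (auto simp: general_linear_def)
  interpret g: Vector_Spaces.linear scale scale g by (rule g(1))
  define w where "w = g \<circ> u"
  have inj_w: "inj_on w {..<r}"
    unfolding w_def using gu(2) inj_on_subset[OF bij_is_inj[OF g(2)] subset_UNIV] by (rule comp_inj_on)
  have ind_w: "V.independent (w ` {..<r})"
    unfolding w_def image_comp[symmetric]
    using gu(3) inj_on_subset[OF bij_is_inj[OF g(2)] subset_UNIV] by (rule g.independent_injective_image)
  define S where "S = (\<Sum>j<r. Poly_Mapping.single (replicate d (w j)) (1::'k))"
  have L_eq: "L = sym_class scale UNIV d S"
    unfolding gu(4) power_sum_def S_def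
    by (subst sym_map_class[OF g(1)]) (simp_all add: free_map_power_sum w_def)
  obtain h where h: "affine_line_morphism scale UNIV d h" "\<forall>t. t \<noteq> 0 \<longrightarrow> h t = sym_map scale UNIV d (\<gamma> t) f"
      "h 0 = L"
    using lim unfolding has_limit_at_0_def by blast
  obtain n X where X: "\<forall>t. h t = sym_class scale UNIV d (\<Sum>i\<le>(n::nat). fscale (t ^ i) (X i))"
    using h(1) unfolding affine_line_morphism_def by blast
  define Q where "Q t = (\<Sum>i\<le>n. fscale (t ^ i) (X i))" for t
  have "Q 0 = (\<Sum>i\<in>{0}. fscale (0 ^ i) (X i))"
    unfolding Q_def by (intro sum.mono_neutral_right) auto
  hence lim_S: "X 0 - S \<in> ?N"
    using X h(3) L_eq by (simp add: Q_def[symmetric] sym_class_eq_iff)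
  have orbit: "free_map (map (\<gamma> t)) T - Q t \<in> ?N" if "t \<noteq> 0" for t
  proof -
    have "sym_class scale UNIV d (free_map (map (\<gamma> t)) T) = sym_map scale UNIV d (\<gamma> t) f"
      unfolding T(2) by (subst sym_map_class[OF lin[OF that]]) simp_all
    thus ?thesis
      using X h(2) that by (simp add: Q_def sym_class_eq_iff[symmetric])
  qed
  obtain I :: "int set" and A where I: "finite I" "0 \<in> I" and A: "\<And>i. Vector_Spaces.linear scale scale (A i)"
    and decomp: "\<And>v. (\<Sum>i\<in>I. A i v) = v"
    and weight: "\<And>i s v. i \<in> I \<Longrightarrow> s \<noteq> 0 \<Longrightarrow> A i (\<gamma> s v) = scale (s powi i) (A i v)"
    using one_param_weights[OF vs \<gamma>] by metis
  have map_null: "free_map (map \<psi>) R \<in> ?N" if "Vector_Spaces.linear scale scale \<psi>" "R \<in> ?N" for \<psi> R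
    using free_map_sym_null[OF that(1) _ that(2), of UNIV] by simp
  have map_Q: "free_map (map \<psi>) (Q t) = (\<Sum>i\<le>n. fscale (t ^ i) (free_map (map \<psi>) (X i)))" for \<psi> t
    by (simp add: Q_def free_map_sum free_map_fscale)
  \<comment> \<open>The limit is fixed: compare the coefficients of \<open>t\<^sup>0\<close> in \<open>\<gamma>(s) (\<gamma>(t) f) = \<gamma>(s t) f\<close>.\<close>
  have fixed: "X 0 - free_map (map (\<gamma> s)) (X 0) \<in> ?N" if s: "s \<noteq> 0" for s
  proof -
    have "(\<Sum>i\<le>n. fscale (t ^ i) (fscale (s ^ i) (X i) - free_map (map (\<gamma> s)) (X i))) \<in> ?N" if t: "t \<noteq> 0" for t
    proof -
      have "(free_map (map (\<gamma> s)) (free_map (map (\<gamma> t)) T - Q t)) - (free_map (map (\<gamma> (s * t))) T - Q (s * t)) \<in> ?N"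
        using s t by (intro sub_diff map_null lin orbit) auto
      also have "(free_map (map (\<gamma> s)) (free_map (map (\<gamma> t)) T - Q t)) - (free_map (map (\<gamma> (s * t))) T - Q (s * t))
          = Q (s * t) - free_map (map (\<gamma> s)) (Q t)"
        using hom[OF s t] by (simp add: free_map_diff free_map_free_map)
      also have "\<dots> = (\<Sum>i\<le>n. fscale (t ^ i) (fscale (s ^ i) (X i) - free_map (map (\<gamma> s)) (X i)))"
        unfolding map_Q by (simp add: Q_def fs.scale_right_diff_distrib sum_subtractf power_mult_distrib mult.commute)
      finally show ?thesis .
    qed
    from polynomial_vanishing_mod_subspace[OF vector_space_fscale sub this, of 0]
    show ?thesis by simp
  qed
  have w_fixed: "A 0 (w j) = w j" if "j < r" for j
  proof (rule fixes_power_sum_imp_weight_zero[OF vs d I A decomp weight _ inj_w ind_w])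
    fix s :: 'k and \<alpha> assume s: "s \<noteq> 0" and \<alpha>: "Vector_Spaces.linear scale (*) \<alpha>"
    have "free_map (map (\<gamma> s)) (X 0 - S) \<in> ?N"
      using lin[OF s] lim_S by (rule map_null)
    from sub_diff[OF sub_diff[OF lim_S fixed[OF s]] this]
    have "free_map (map (\<gamma> s)) S - S \<in> ?N"
      by (simp add: free_map_diff)
    from tensor_eval_cong_sym_null[OF \<alpha> this]
    show "(\<Sum>j<r. \<alpha> (\<gamma> s (w j)) ^ d) = (\<Sum>j<r. \<alpha> (w j) ^ d)"
      unfolding S_def free_map_power_sum tensor_eval_power_sum .
  qed (use that in auto)
  \<comment> \<open>Applying \<open>A\<^sub>0\<close> to the family \<open>\<gamma>(t) f\<close> makes it constant, so \<open>A\<^sub>0 f\<close> is \<open>A\<^sub>0\<close> of the limit.\<close>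
  have "free_map (map (A 0)) T - S \<in> ?N"
  proof -
    have A0: "map (A 0) \<circ> map (\<gamma> t) = map (A 0)" if "t \<noteq> 0" for t
      using weight[OF I(2) that] by (auto simp: fun_eq_iff)
    have "(\<Sum>i\<le>n. fscale (t ^ i) ((if i = 0 then free_map (map (A 0)) T else 0) - free_map (map (A 0)) (X i))) \<in> ?N"
      if t: "t \<noteq> 0" for t
    proof -
      have "free_map (map (A 0)) (free_map (map (\<gamma> t)) T - Q t) \<in> ?N"
        using A orbit[OF t] by (rule map_null)
      also have "free_map (map (A 0)) (free_map (map (\<gamma> t)) T - Q t)
          = free_map (map (A 0)) T - free_map (map (A 0)) (Q t)"
        using A0[OF t] by (simp add: free_map_diff free_map_free_map)
      also have "free_map (map (A 0)) T = (\<Sum>i\<le>n. fscale (t ^ i) (if i = 0 then free_map (map (A 0)) T else 0))"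
        by (subst sum.mono_neutral_right[of "{..n}" "{0}"]) auto
      finally show ?thesis
        unfolding map_Q by (simp add: fs.scale_right_diff_distrib sum_subtractf)
    qed
    from polynomial_vanishing_mod_subspace[OF vector_space_fscale sub this, of 0]
    have "free_map (map (A 0)) T - free_map (map (A 0)) (X 0) \<in> ?N" by simp
    moreover have "free_map (map (A 0)) (X 0 - S) \<in> ?N"
      using A lim_S by (rule map_null)
    ultimately have "(free_map (map (A 0)) T - free_map (map (A 0)) (X 0)) + free_map (map (A 0)) (X 0 - S) \<in> ?N"
      by (rule sub_add)
    moreover have "free_map (map (A 0)) S = S"
      by (simp add: S_def free_map_power_sum w_fixed)
    ultimately show ?thesis by (simp add: free_map_diff)
  qed
  moreover obtain \<psi> where \<psi>: "Vector_Spaces.linear scale fscale \<psi>"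
      "\<forall>x\<in>w ` {..<r}. \<psi> x = coord_vec (the_inv_into {..<r} w x)"
      "range \<psi> = fs.span ((\<lambda>x. coord_vec (the_inv_into {..<r} w x)) ` w ` {..<r})"
    using P.linear_independent_extend_subspace[OF ind_w, of "\<lambda>x. coord_vec (the_inv_into {..<r} w x)"] by blast
  have \<psi>_w: "\<psi> (w j) = coord_vec j" if "j < r" for j
    using \<psi>(2) that by (simp add: the_inv_into_f_f[OF inj_w])
  have "(\<lambda>x. coord_vec (the_inv_into {..<r} w x)) ` w ` {..<r} = (coord_vec ` {..<r} :: (nat \<Rightarrow>\<^sub>0 'k) set)"
    by (force simp: image_image the_inv_into_f_f[OF inj_w])
  hence range_\<psi>: "range \<psi> = coord_space r"
    using \<psi>(3) by (simp add: coord_space_eq_span)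
  ultimately have "free_map (map \<psi>) (free_map (map (A 0)) T - S) \<in> sym_null fscale (coord_space r) d"
    by (intro free_map_sym_null[OF \<psi>(1)]) auto
  hence "sym_class fscale (coord_space r) d (free_map (map (\<psi> \<circ> A 0)) T) = unit_tensor d r"
    unfolding unit_tensor_def power_sum_def sym_class_eq_iff
    by (simp add: free_map_diff free_map_free_map S_def free_map_power_sum \<psi>_w comp_def)
  moreover have lin_\<phi>: "Vector_Spaces.linear scale fscale (\<psi> \<circ> A 0)"
    by (rule Vector_Spaces.linear_compose[OF A \<psi>(1)])
  moreover have "range (\<psi> \<circ> A 0) \<subseteq> coord_space r"
    using range_\<psi> by auto
  moreover from this have "sym_map fscale (coord_space r) d (\<psi> \<circ> A 0) f
      = sym_class fscale (coord_space r) d (free_map (map (\<psi> \<circ> A 0)) T)"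
    unfolding T(2) by (rule sym_map_class[OF lin_\<phi>])
  ultimately show ?thesis by metis
qed

theorem theorem1p6:
  fixes scale :: "'k::alg_closed_field \<Rightarrow> 'v::ab_group_add \<Rightarrow> 'v"
    and Basis :: "'v set"
    and d :: nat
    and f :: "('v list \<Rightarrow>\<^sub>0 'k) set"
  assumes "finite_dimensional_vector_space scale Basis"
    and "\<not> (\<exists>c\<in>{0, 1, 2}. \<exists>k. d = c * characteristic_exponent TYPE('k) ^ k)"
    and "f \<in> sym_power scale UNIV d"
  shows "sym_HM_subrank scale d f = sym_subrank scale d f"
proof -
  interpret finite_dimensional_vector_space scale Basis by (rule assms(1))
  obtain k m where d: "d = characteristic_exponent TYPE('k) ^ k * m" "of_nat m \<noteq> (0::'k)" "m \<ge> 3"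
    using prime_to_characteristic_part[OF assms(2)] .
  have "(\<exists>\<gamma>. one_param_subgroup scale \<gamma> \<and>
            (\<exists>L\<in>unit_orbit scale d r. has_limit_at_0 scale UNIV d (\<lambda>t. sym_map scale UNIV d (\<gamma> t) f) L))
      \<longleftrightarrow> (\<exists>\<phi>. Vector_Spaces.linear scale fscale \<phi> \<and> range \<phi> \<subseteq> coord_space r
                 \<and> sym_map fscale (coord_space r) d \<phi> f = unit_tensor d r)" for r
    using HM_imp_subrank[OF vector_space_axioms d assms(3)]
      subrank_imp_HM[OF vector_space_axioms d assms(3)] by metis
  thus ?thesis
    unfolding sym_HM_subrank_def sym_subrank_def by simp
qed


end
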